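(* Let $\mathcal F[\sigma]$ be a fragment of logic equivalent to a local variety of finite monoids $\mathbf V$. Let $L\subseteq A^*$ be a regular language and let $s$ be its stability index. Then the following statements are equivalent: (1) $L$ belongs to $\mathcal F[\sigma,\mathrm{MOD}]$; (2) $L$ belongs to $\mathcal F[\sigma,\mathrm{MOD}^s]$; (3) the stable monoid of $L$ belongs to $\mathbf V$. Furthermore, if $\mathcal F[\sigma]$ is decidable, then so is $\mathcal F[\sigma,\mathrm{MOD}]$.
   Context: Logic. A word $u$ over a finite alphabet $A$ is a set of positions $0,\dots,|u|-1$ labelled by letters. Formulas are monadic second order formulas over words; a signature $\sigma$ is a set of numerical predicates, and letter predicates $\mathbf a(x)$ (position $x$ carries letter $a$) are always available, for letters of any finite alphabet. A fragment of logic $\mathcal F[\sigma]$ is a set of closed formulas of $\mathrm{MSO}[\sigma]$ that contains the quantifier-free formulas and is closed under conjunction, disjunction and quantifier-free substitution (if $\varphi\in\mathcal F[\sigma]$ and $\psi(x_1,\dots,x_n)$ is a quantifier-free subformula of $\varphi$, then replacing $\psi$ by another quantifier-free formula over $\sigma$ with the same set of free variables gives a formula of $\mathcal F[\sigma]$). For a class of predicates $\sigma'$, the enrichment $\mathcal F[\sigma,\sigma']$ is the closure of $\mathcal F[\sigma]$ under quantifier-free substitutions with predicates ranging over $\sigma\cup\sigma'$. $\mathcal F[\sigma]$ also denotes the class of languages defined by its formulas (over each finite alphabet). For $d\ge 1$, $\mathrm{MOD}^d$ consists of, for $0\le i<d$, the unary predicates $\mathbf{MOD}_i^d(x)$ (position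 $x$ is congruent to $i$ mod $d$) and the constants $\mathbf D_i^d$ (the length of the word is congruent to $i$ mod $d$); $\mathrm{MOD}=\bigcup_{d\ge1}\mathrm{MOD}^d$. A fragment is decidable if, given a regular language, one can decide whether it is definable by a formula of the fragment. Algebra. A variety of monoids is a nonempty class of finite monoids closed under division (quotients of submonoids) and finite direct products. $\mathcal F[\sigma]$ is equivalent to $\mathbf V$ if the languages definable in $\mathcal F[\sigma]$ are exactly those recognized by a monoid of $\mathbf V$. For a morphism $\varphi:A^*\to M$ to a finite monoid, the stability index is the least positive integer $s$ with $\varphi(A^s)=\varphi(A^{2s})$, and the stable monoid is $\varphi((A^s)^* )$. The stability index and stable monoid of a regular language are those of its syntactic morphism. Categories. Categories are finite; a monoid is a one-object category. A division of categories $\tau:C\to D$ is a map on objects together with, for each pair of objects $e,f$ of $C$, a relation $\tau:C(e,f)\to D(\tau(e),\tau(f))$ such that $\tau(x)\tau(y)\subseteq\tau(xy)$ for consecutive arrows $x,y$; $\tau(x)\ne\emptyset$ for every arrow $x$; $1_{\tau(e)}\in\tau(1_e)$ for every object $e$; and $\tau(x)\cap\tau(y)=\emptyset$ for distinct coterminal arrows $x,y$ (same source and same target). $\mathbf{gV}$ is the class of all categories dividing a monoid of $\mathbf V$. $\ell\mathbf V$ is the class of all categories whose local monoids (the monoids $C(x,x)$, $x$ an object) are all in $\mathbf V$. $\mathbf V$ is local if $\mathbf{gV}=\ell\mathbf V$. *)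

theory Defs
  imports "HOL-Algebra.Group" "HOL-Library.Nat_Bijection"
begin

section \<open>Monadic second-order logic over words\<close>

text \<open>A numerical predicate is identified with its interpretation: given the length of the
  word and the list of positions it is applied to, does it hold? It may depend on the length, so
  that the predicates of arity 0 are constants.\<close>

datatype num_pred = Num_Pred (arity: nat) (rel: "nat \<Rightarrow> nat list \<Rightarrow> bool")

text \<open>Letters are natural numbers and alphabets are finite sets of naturals. First-order
  and second-order variables are two separate copies of the naturals. Equality of positions is a
  numerical predicate like any other, hence it is available only if the signature contains it.\<close>

datatype formula =
    Tr
  | Fa
  | Letter nat nat
  | Pred num_pred "nat list"
  | Mem nat nat
  | Neg formula
  | Conj formula formula
  | Disj formula formula
  | Ex1 nat formula
  | All1 nat formula
  | Ex2 nat formula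
  | All2 nat formula

fun sat :: "nat list \<Rightarrow> (nat \<Rightarrow> nat) \<Rightarrow> (nat \<Rightarrow> nat set) \<Rightarrow> formula \<Rightarrow> bool" where
  "sat w v V Tr \<longleftrightarrow> True"
| "sat w v V Fa \<longleftrightarrow> False"
| "sat w v V (Letter a x) \<longleftrightarrow> v x < length w \<and> w ! v x = a"
| "sat w v V (Pred p xs) \<longleftrightarrow> rel p (length w) (map v xs)"
| "sat w v V (Mem x X) \<longleftrightarrow> v x \<in> V X"
| "sat w v V (Neg \<phi>) \<longleftrightarrow> \<not> sat w v V \<phi>"
| "sat w v V (Conj \<phi> \<psi>) \<longleftrightarrow> sat w v V \<phi> \<and> sat w v V \<psi>"
| "sat w v V (Disj \<phi> \<psi>) \<longleftrightarrow> sat w v V \<phi> \<or> sat w v V \<psi>"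
| "sat w v V (Ex1 x \<phi>) \<longleftrightarrow> (\<exists>i<length w. sat w (v(x := i)) V \<phi>)"
| "sat w v V (All1 x \<phi>) \<longleftrightarrow> (\<forall>i<length w. sat w (v(x := i)) V \<phi>)"
| "sat w v V (Ex2 X \<phi>) \<longleftrightarrow> (\<exists>S\<subseteq>{..<length w}. sat w v (V(X := S)) \<phi>)"
| "sat w v V (All2 X \<phi>) \<longleftrightarrow> (\<forall>S\<subseteq>{..<length w}. sat w v (V(X := S)) \<phi>)"

fun fv1 :: "formula \<Rightarrow> nat set" where
  "fv1 Tr = {}"
| "fv1 Fa = {}"
| "fv1 (Letter a x) = {x}"
| "fv1 (Pred p xs) = set xs"
| "fv1 (Mem x X) = {x}"
| "fv1 (Neg \<phi>) = fv1 \<phi>"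
| "fv1 (Conj \<phi> \<psi>) = fv1 \<phi> \<union> fv1 \<psi>"
| "fv1 (Disj \<phi> \<psi>) = fv1 \<phi> \<union> fv1 \<psi>"
| "fv1 (Ex1 x \<phi>) = fv1 \<phi> - {x}"
| "fv1 (All1 x \<phi>) = fv1 \<phi> - {x}"
| "fv1 (Ex2 X \<phi>) = fv1 \<phi>"
| "fv1 (All2 X \<phi>) = fv1 \<phi>"

fun fv2 :: "formula \<Rightarrow> nat set" where
  "fv2 Tr = {}"
| "fv2 Fa = {}"
| "fv2 (Letter a x) = {}"
| "fv2 (Pred p xs) = {}"
| "fv2 (Mem x X) = {X}"
| "fv2 (Neg \<phi>) = fv2 \<phi>"
| "fv2 (Conj \<phi> \<psi>) = fv2 \<phi> \<union> fv2 \<psi>"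
| "fv2 (Disj \<phi> \<psi>) = fv2 \<phi> \<union> fv2 \<psi>"
| "fv2 (Ex1 x \<phi>) = fv2 \<phi>"
| "fv2 (All1 x \<phi>) = fv2 \<phi>"
| "fv2 (Ex2 X \<phi>) = fv2 \<phi> - {X}"
| "fv2 (All2 X \<phi>) = fv2 \<phi> - {X}"

definition closed_formula :: "formula \<Rightarrow> bool" where
  "closed_formula \<phi> \<longleftrightarrow> fv1 \<phi> = {} \<and> fv2 \<phi> = {}"

fun qfree :: "formula \<Rightarrow> bool" where
  "qfree (Neg \<phi>) \<longleftrightarrow> qfree \<phi>"
| "qfree (Conj \<phi> \<psi>) \<longleftrightarrow> qfree \<phi> \<and> qfree \<psi>"
| "qfree (Disj \<phi> \<psi>) \<longleftrightarrow> qfree \<phi> \<and> qfree \<psi>"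
| "qfree (Ex1 x \<phi>) \<longleftrightarrow> False"
| "qfree (All1 x \<phi>) \<longleftrightarrow> False"
| "qfree (Ex2 X \<phi>) \<longleftrightarrow> False"
| "qfree (All2 X \<phi>) \<longleftrightarrow> False"
| "qfree _ \<longleftrightarrow> True"

fun MSO :: "num_pred set \<Rightarrow> formula \<Rightarrow> bool" where
  "MSO \<sigma> (Pred p xs) \<longleftrightarrow> p \<in> \<sigma> \<and> length xs = arity p"
| "MSO \<sigma> (Neg \<phi>) \<longleftrightarrow> MSO \<sigma> \<phi>"
| "MSO \<sigma> (Conj \<phi> \<psi>) \<longleftrightarrow> MSO \<sigma> \<phi> \<and> MSO \<sigma> \<psi>"
| "MSO \<sigma> (Disj \<phi> \<psi>) \<longleftrightarrow> MSO \<sigma> \<phi> \<and> MSO \<sigma> \<psi>"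
| "MSO \<sigma> (Ex1 x \<phi>) \<longleftrightarrow> MSO \<sigma> \<phi>"
| "MSO \<sigma> (All1 x \<phi>) \<longleftrightarrow> MSO \<sigma> \<phi>"
| "MSO \<sigma> (Ex2 X \<phi>) \<longleftrightarrow> MSO \<sigma> \<phi>"
| "MSO \<sigma> (All2 X \<phi>) \<longleftrightarrow> MSO \<sigma> \<phi>"
| "MSO \<sigma> _ \<longleftrightarrow> True"

section \<open>Fragments and enrichment\<close>

text \<open>\<open>qf_subst \<tau> \<phi> \<phi>'\<close>: \<open>\<phi>'\<close> is obtained from \<open>\<phi>\<close> by replacing one occurrence of a
  quantifier-free subformula by a quantifier-free formula over \<open>\<tau>\<close> with the same free
  variables.\<close>

inductive qf_subst :: "num_pred set \<Rightarrow> formula \<Rightarrow> formula \<Rightarrow> bool" for \<tau> where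
  here: "\<lbrakk>qfree \<psi>; qfree \<psi>'; MSO \<tau> \<psi>'; fv1 \<psi>' = fv1 \<psi>; fv2 \<psi>' = fv2 \<psi>\<rbrakk> \<Longrightarrow> qf_subst \<tau> \<psi> \<psi>'"
| Neg: "qf_subst \<tau> \<phi> \<phi>' \<Longrightarrow> qf_subst \<tau> (Neg \<phi>) (Neg \<phi>')"
| Conj1: "qf_subst \<tau> \<phi> \<phi>' \<Longrightarrow> qf_subst \<tau> (Conj \<phi> \<psi>) (Conj \<phi>' \<psi>)"
| Conj2: "qf_subst \<tau> \<psi> \<psi>' \<Longrightarrow> qf_subst \<tau> (Conj \<phi> \<psi>) (Conj \<phi> \<psi>')"
| Disj1: "qf_subst \<tau> \<phi> \<phi>' \<Longrightarrow> qf_subst \<tau> (Disj \<phi> \<psi>) (Disj \<phi>' \<psi>)"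
| Disj2: "qf_subst \<tau> \<psi> \<psi>' \<Longrightarrow> qf_subst \<tau> (Disj \<phi> \<psi>) (Disj \<phi> \<psi>')"
| Ex1: "qf_subst \<tau> \<phi> \<phi>' \<Longrightarrow> qf_subst \<tau> (Ex1 x \<phi>) (Ex1 x \<phi>')"
| All1: "qf_subst \<tau> \<phi> \<phi>' \<Longrightarrow> qf_subst \<tau> (All1 x \<phi>) (All1 x \<phi>')"
| Ex2: "qf_subst \<tau> \<phi> \<phi>' \<Longrightarrow> qf_subst \<tau> (Ex2 X \<phi>) (Ex2 X \<phi>')"
| All2: "qf_subst \<tau> \<phi> \<phi>' \<Longrightarrow> qf_subst \<tau> (All2 X \<phi>) (All2 X \<phi>')"

definition fragment :: "num_pred set \<Rightarrow> formula set \<Rightarrow> bool" where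
  "fragment \<sigma> F \<longleftrightarrow>
     (\<forall>\<phi>\<in>F. closed_formula \<phi> \<and> MSO \<sigma> \<phi>) \<and>
     (\<forall>\<phi>. closed_formula \<phi> \<and> MSO \<sigma> \<phi> \<and> qfree \<phi> \<longrightarrow> \<phi> \<in> F) \<and>
     (\<forall>\<phi>\<in>F. \<forall>\<psi>\<in>F. Conj \<phi> \<psi> \<in> F \<and> Disj \<phi> \<psi> \<in> F) \<and>
     (\<forall>\<phi>\<in>F. \<forall>\<phi>'. qf_subst \<sigma> \<phi> \<phi>' \<longrightarrow> \<phi>' \<in> F)"

inductive_set enrich :: "num_pred set \<Rightarrow> formula set \<Rightarrow> num_pred set \<Rightarrow> formula set"
  for \<sigma> F \<sigma>' where
  base: "\<phi> \<in> F \<Longrightarrow> \<phi> \<in> enrich \<sigma> F \<sigma>'"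
| subst: "\<phi> \<in> enrich \<sigma> F \<sigma>' \<Longrightarrow> qf_subst (\<sigma> \<union> \<sigma>') \<phi> \<phi>' \<Longrightarrow> \<phi>' \<in> enrich \<sigma> F \<sigma>'"

definition mod_pred :: "nat \<Rightarrow> nat \<Rightarrow> num_pred" where
  "mod_pred d i = Num_Pred 1 (\<lambda>n ps. hd ps mod d = i)"

definition mod_const :: "nat \<Rightarrow> nat \<Rightarrow> num_pred" where
  "mod_const d i = Num_Pred 0 (\<lambda>n ps. n mod d = i)"

definition MOD_at :: "nat \<Rightarrow> num_pred set" where
  "MOD_at d = {mod_pred d i |i. i < d} \<union> {mod_const d i |i. i < d}"

definition MOD :: "num_pred set" where
  "MOD = (\<Union>d\<in>{1..}. MOD_at d)"

text \<open>The valuations are irrelevant for closed formulas.\<close>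

definition formula_lang :: "nat set \<Rightarrow> formula \<Rightarrow> nat list set" where
  "formula_lang A \<phi> = {w \<in> lists A. sat w (\<lambda>_. 0) (\<lambda>_. {}) \<phi>}"

definition definable :: "formula set \<Rightarrow> nat set \<Rightarrow> nat list set \<Rightarrow> bool" where
  "definable F A L \<longleftrightarrow> (\<exists>\<phi>\<in>F. L = formula_lang A \<phi>)"

section \<open>Varieties of monoids and recognition\<close>

definition monoid_morphism :: "'a monoid \<Rightarrow> 'b monoid \<Rightarrow> ('a \<Rightarrow> 'b) \<Rightarrow> bool" where
  "monoid_morphism M N h \<longleftrightarrow> h \<in> hom M N \<and> h \<one>\<^bsub>M\<^esub> = \<one>\<^bsub>N\<^esub>"

definition monoid_divides :: "'a monoid \<Rightarrow> 'b monoid \<Rightarrow> bool" where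
  "monoid_divides N M \<longleftrightarrow>
     (\<exists>T h. submonoid T M \<and> monoid_morphism (M\<lparr>carrier := T\<rparr>) N h \<and> h ` T = carrier N)"

text \<open>A class of finite monoids is represented by its members whose carrier consists of
  naturals; since the classes considered are closed under isomorphism, a finite monoid over any
  other type belongs to the class iff it is isomorphic to such a member.\<close>

definition belongs :: "'a monoid \<Rightarrow> nat monoid set \<Rightarrow> bool" where
  "belongs M \<V> \<longleftrightarrow> (\<exists>N\<in>\<V>. M \<cong> N)"

definition monoid_variety :: "nat monoid set \<Rightarrow> bool" where
  "monoid_variety \<V> \<longleftrightarrow>
     \<V> \<noteq> {} \<and>
     (\<forall>M\<in>\<V>. monoid M \<and> finite (carrier M)) \<and>
     (\<forall>M\<in>\<V>. \<forall>N :: nat monoid. monoid N \<and> monoid_divides N M \<longrightarrow> N \<in> \<V>) \<and>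
     (\<forall>M\<in>\<V>. \<forall>N\<in>\<V>. belongs (M \<times>\<times> N) \<V>)"

definition free_monoid :: "'a set \<Rightarrow> 'a list monoid" where
  "free_monoid A = \<lparr>carrier = lists A, monoid.mult = (@), one = []\<rparr>"

definition recognizes :: "'m monoid \<Rightarrow> 'a set \<Rightarrow> 'a list set \<Rightarrow> bool" where
  "recognizes M A L \<longleftrightarrow>
     (\<exists>h P. monoid_morphism (free_monoid A) M h \<and> P \<subseteq> carrier M \<and> L = {w \<in> lists A. h w \<in> P})"

definition equivalent :: "formula set \<Rightarrow> nat monoid set \<Rightarrow> bool" where
  "equivalent F \<V> \<longleftrightarrow>
     (\<forall>A L. finite A \<and> L \<subseteq> lists A \<longrightarrow> (definable F A L \<longleftrightarrow> (\<exists>M\<in>\<V>. recognizes M A L)))"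

section \<open>Syntactic and stable monoids\<close>

definition syntactic_cong :: "'a set \<Rightarrow> 'a list set \<Rightarrow> ('a list \<times> 'a list) set" where
  "syntactic_cong A L =
     {(u, v). u \<in> lists A \<and> v \<in> lists A \<and>
        (\<forall>p\<in>lists A. \<forall>q\<in>lists A. p @ u @ q \<in> L \<longleftrightarrow> p @ v @ q \<in> L)}"

definition syntactic_morphism :: "'a set \<Rightarrow> 'a list set \<Rightarrow> 'a list \<Rightarrow> 'a list set" where
  "syntactic_morphism A L u = syntactic_cong A L `` {u}"

definition syntactic_monoid :: "'a set \<Rightarrow> 'a list set \<Rightarrow> 'a list set monoid" where
  "syntactic_monoid A L =
     \<lparr>carrier = lists A // syntactic_cong A L,
      monoid.mult = (\<lambda>X Y. \<Union>u\<in>X. \<Union>v\<in>Y. syntactic_morphism A L (u @ v)),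
      one = syntactic_morphism A L []\<rparr>"

definition words :: "'a set \<Rightarrow> nat \<Rightarrow> 'a list set" where
  "words A n = {w \<in> lists A. length w = n}"

definition stability_index :: "'a set \<Rightarrow> ('a list \<Rightarrow> 'm) \<Rightarrow> nat" where
  "stability_index A h = (LEAST s. s > 0 \<and> h ` words A s = h ` words A (2 * s))"

definition stable_monoid :: "'a set \<Rightarrow> 'm monoid \<Rightarrow> ('a list \<Rightarrow> 'm) \<Rightarrow> 'm monoid" where
  "stable_monoid A M h =
     M\<lparr>carrier := h ` {concat ws |ws. ws \<in> lists (words A (stability_index A h))}\<rparr>"

definition lang_stability_index :: "'a set \<Rightarrow> 'a list set \<Rightarrow> nat" where
  "lang_stability_index A L = stability_index A (syntactic_morphism A L)"

definition lang_stable_monoid :: "'a set \<Rightarrow> 'a list set \<Rightarrow> 'a list set monoid" where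
  "lang_stable_monoid A L = stable_monoid A (syntactic_monoid A L) (syntactic_morphism A L)"

section \<open>Finite categories and locality\<close>

text \<open>Composition is written in diagrammatic order: \<open>Comp C x y\<close> is \<open>x\<close> followed by \<open>y\<close>.\<close>

record ('o, 'm) cat =
  Obj :: "'o set"
  Arr :: "'m set"
  Dom :: "'m \<Rightarrow> 'o"
  Cod :: "'m \<Rightarrow> 'o"
  Id :: "'o \<Rightarrow> 'm"
  Comp :: "'m \<Rightarrow> 'm \<Rightarrow> 'm"

definition arrows :: "('o, 'm) cat \<Rightarrow> 'o \<Rightarrow> 'o \<Rightarrow> 'm set" where
  "arrows C e f = {x \<in> Arr C. Dom C x = e \<and> Cod C x = f}"

definition finite_category :: "('o, 'm) cat \<Rightarrow> bool" where
  "finite_category C \<longleftrightarrow>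
     finite (Obj C) \<and> finite (Arr C) \<and>
     (\<forall>x\<in>Arr C. Dom C x \<in> Obj C \<and> Cod C x \<in> Obj C) \<and>
     (\<forall>e\<in>Obj C. Id C e \<in> arrows C e e) \<and>
     (\<forall>x\<in>Arr C. \<forall>y\<in>Arr C. Cod C x = Dom C y \<longrightarrow> Comp C x y \<in> arrows C (Dom C x) (Cod C y)) \<and>
     (\<forall>x\<in>Arr C. Comp C (Id C (Dom C x)) x = x \<and> Comp C x (Id C (Cod C x)) = x) \<and>
     (\<forall>x\<in>Arr C. \<forall>y\<in>Arr C. \<forall>z\<in>Arr C. Cod C x = Dom C y \<and> Cod C y = Dom C z \<longrightarrow>
        Comp C (Comp C x y) z = Comp C x (Comp C y z))"

definition monoid_cat :: "'m monoid \<Rightarrow> (unit, 'm) cat" where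
  "monoid_cat M =
     \<lparr>Obj = UNIV, Arr = carrier M, Dom = (\<lambda>_. ()), Cod = (\<lambda>_. ()),
      Id = (\<lambda>_. \<one>\<^bsub>M\<^esub>), Comp = monoid.mult M\<rparr>"

definition local_monoid :: "('o, 'm) cat \<Rightarrow> 'o \<Rightarrow> 'm monoid" where
  "local_monoid C e = \<lparr>carrier = arrows C e e, monoid.mult = Comp C, one = Id C e\<rparr>"

definition cat_division ::
  "('o, 'm) cat \<Rightarrow> ('p, 'n) cat \<Rightarrow> ('o \<Rightarrow> 'p) \<Rightarrow> ('m \<Rightarrow> 'n set) \<Rightarrow> bool" where
  "cat_division C D \<theta> \<tau> \<longleftrightarrow>
     (\<forall>e\<in>Obj C. \<theta> e \<in> Obj D) \<and>
     (\<forall>x\<in>Arr C. \<tau> x \<subseteq> arrows D (\<theta> (Dom C x)) (\<theta> (Cod C x))) \<and>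
     (\<forall>x\<in>Arr C. \<forall>y\<in>Arr C. Cod C x = Dom C y \<longrightarrow>
        {Comp D a b |a b. a \<in> \<tau> x \<and> b \<in> \<tau> y} \<subseteq> \<tau> (Comp C x y)) \<and>
     (\<forall>x\<in>Arr C. \<tau> x \<noteq> {}) \<and>
     (\<forall>e\<in>Obj C. Id D (\<theta> e) \<in> \<tau> (Id C e)) \<and>
     (\<forall>x\<in>Arr C. \<forall>y\<in>Arr C. Dom C x = Dom C y \<and> Cod C x = Cod C y \<and> x \<noteq> y \<longrightarrow> \<tau> x \<inter> \<tau> y = {})"

definition cat_divides :: "('o, 'm) cat \<Rightarrow> ('p, 'n) cat \<Rightarrow> bool" where
  "cat_divides C D \<longleftrightarrow> (\<exists>\<theta> \<tau>. cat_division C D \<theta> \<tau>)"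

definition global_cats :: "nat monoid set \<Rightarrow> ('o, 'm) cat set" where
  "global_cats \<V> = {C. finite_category C \<and> (\<exists>M\<in>\<V>. cat_divides C (monoid_cat M))}"

definition local_cats :: "nat monoid set \<Rightarrow> ('o, 'm) cat set" where
  "local_cats \<V> = {C. finite_category C \<and> (\<forall>e\<in>Obj C. belongs (local_monoid C e) \<V>)}"

text \<open>Every finite category is isomorphic to one whose objects and arrows are naturals.\<close>

definition local_variety :: "nat monoid set \<Rightarrow> bool" where
  "local_variety \<V> \<longleftrightarrow> (global_cats \<V> :: (nat, nat) cat set) = local_cats \<V>"

section \<open>Regular languages and decidability\<close>

text \<open>The states are \<open>0, \<dots>, length (table D) - 1\<close>; row \<open>q\<close> of the table lists the successors
  of \<open>q\<close> in the order of the list of letters.\<close>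

record dfa =
  letters :: "nat list"
  table :: "nat list list"
  start :: nat
  finals :: "nat list"

definition wf_dfa :: "dfa \<Rightarrow> bool" where
  "wf_dfa D \<longleftrightarrow>
     distinct (letters D) \<and> start D < length (table D) \<and>
     (\<forall>row\<in>set (table D). length row = length (letters D) \<and> (\<forall>q\<in>set row. q < length (table D))) \<and>
     (\<forall>q\<in>set (finals D). q < length (table D))"

definition dfa_step :: "dfa \<Rightarrow> nat \<Rightarrow> nat \<Rightarrow> nat" where
  "dfa_step D q a = the (map_of (zip (letters D) (table D ! q)) a)"

definition dfa_lang :: "dfa \<Rightarrow> nat list set" where
  "dfa_lang D = {w \<in> lists (set (letters D)). foldl (dfa_step D) (start D) w \<in> set (finals D)}"

definition regular :: "nat set \<Rightarrow> nat list set \<Rightarrow> bool" where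
  "regular A L \<longleftrightarrow> (\<exists>D. wf_dfa D \<and> set (letters D) = A \<and> dfa_lang D = L)"

definition dfa_encode :: "dfa \<Rightarrow> nat" where
  "dfa_encode D =
     prod_encode (list_encode (letters D),
       prod_encode (list_encode (map list_encode (table D)),
         prod_encode (start D, list_encode (finals D))))"

text \<open>Total recursive functions, in unary form: several arguments are passed through the
  pairing function \<open>prod_encode\<close>. Minimization is applied to regular functions only, which by
  Kleene's normal form theorem yields exactly the total computable functions.\<close>

inductive recursive :: "(nat \<Rightarrow> nat) \<Rightarrow> bool" where
  zero: "recursive (\<lambda>n. 0)"
| suc: "recursive Suc"
| left: "recursive (\<lambda>n. fst (prod_decode n))"
| right: "recursive (\<lambda>n. snd (prod_decode n))"
| pair: "recursive f \<Longrightarrow> recursive g \<Longrightarrow> recursive (\<lambda>n. prod_encode (f n, g n))"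
| comp: "recursive f \<Longrightarrow> recursive g \<Longrightarrow> recursive (\<lambda>n. f (g n))"
| prim_rec: "recursive f \<Longrightarrow> recursive g \<Longrightarrow>
    recursive (\<lambda>n. case prod_decode n of (a, k) \<Rightarrow>
      rec_nat (f a) (\<lambda>m r. g (prod_encode (a, prod_encode (m, r)))) k)"
| mu: "recursive f \<Longrightarrow> (\<And>n. \<exists>m. f (prod_encode (n, m)) = 0) \<Longrightarrow>
    recursive (\<lambda>n. LEAST m. f (prod_encode (n, m)) = 0)"

text \<open>A regular language is given by an automaton, so the behaviour of the decision procedure
  on numbers that do not encode an automaton is irrelevant.\<close>

definition decidable_fragment :: "formula set \<Rightarrow> bool" where
  "decidable_fragment F \<longleftrightarrow>
     (\<exists>f. recursive f \<and>
        (\<forall>D. wf_dfa D \<longrightarrow>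
           f (dfa_encode D) = (if definable F (set (letters D)) (dfa_lang D) then 1 else 0)))"

end

theory Submission
  imports Defs
begin

text \<open>Annotating every letter of a word with its position modulo \<open>d\<close> turns modular predicates
  into letter predicates. If \<open>L\<close> is definable with predicates modulo \<open>d\<close>, where \<open>d\<close> may be
  taken to be a multiple of the stability index \<open>s\<close>, then for each length modulo \<open>d\<close> the annotated
  words of \<open>L\<close> are recognized by a monoid in the variety; on words of length divisible by \<open>d\<close>
  annotation with a fixed offset is a morphism, so the stable monoid is in the variety.

  Conversely, consider the category with objects the residues modulo \<open>s\<close>, whose arrows from \<open>i\<close>
  are the syntactic classes of words, together with the residue \<open>i\<close> plus the length. All its local
  monoids are isomorphic to the stable monoid, so by locality it divides a monoid of the variety;
  choosing an image for each one-letter arrow gives a morphism on annotated words which, given the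
  length modulo \<open>s\<close>, determines the syntactic class.

  For decidability, the stable monoid can be computed with any \<open>t\<close> such that words of lengths \<open>t\<close>
  and \<open>2 t\<close> have the same syntactic classes. It is generated by the blocks of length \<open>t\<close>, and
  belongs to the variety iff all the languages of block words \<open>w\<close> such that \<open>u w v\<close> is in \<open>L\<close>,
  for short contexts \<open>u\<close> and \<open>v\<close>, are definable in the original fragment. Automata for these
  finitely many languages are computed from an automaton for \<open>L\<close>.\<close>

section \<open>Substitution of atomic formulas\<close>

fun map_atoms :: "(formula \<Rightarrow> formula) \<Rightarrow> formula \<Rightarrow> formula" where
  "map_atoms g (Neg \<phi>) = Neg (map_atoms g \<phi>)"
| "map_atoms g (Conj \<phi> \<psi>) = Conj (map_atoms g \<phi>) (map_atoms g \<psi>)"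
| "map_atoms g (Disj \<phi> \<psi>) = Disj (map_atoms g \<phi>) (map_atoms g \<psi>)"
| "map_atoms g (Ex1 x \<phi>) = Ex1 x (map_atoms g \<phi>)"
| "map_atoms g (All1 x \<phi>) = All1 x (map_atoms g \<phi>)"
| "map_atoms g (Ex2 X \<phi>) = Ex2 X (map_atoms g \<phi>)"
| "map_atoms g (All2 X \<phi>) = All2 X (map_atoms g \<phi>)"
| "map_atoms g Tr = g Tr"
| "map_atoms g Fa = g Fa"
| "map_atoms g (Letter a x) = g (Letter a x)"
| "map_atoms g (Pred p xs) = g (Pred p xs)"
| "map_atoms g (Mem x X) = g (Mem x X)"

fun atomic :: "formula \<Rightarrow> bool" where
  "atomic (Neg \<phi>) \<longleftrightarrow> False"
| "atomic (Conj \<phi> \<psi>) \<longleftrightarrow> False"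
| "atomic (Disj \<phi> \<psi>) \<longleftrightarrow> False"
| "atomic (Ex1 x \<phi>) \<longleftrightarrow> False"
| "atomic (All1 x \<phi>) \<longleftrightarrow> False"
| "atomic (Ex2 X \<phi>) \<longleftrightarrow> False"
| "atomic (All2 X \<phi>) \<longleftrightarrow> False"
| "atomic _ \<longleftrightarrow> True"

text \<open>These are the conditions of a single \<open>qf_subst\<close> step at an atom. They
  concern only atoms over \<open>\<sigma>\<close>, so \<open>g\<close> may act arbitrarily on other
  predicates.\<close>

definition atom_subst :: "num_pred set \<Rightarrow> num_pred set \<Rightarrow> (formula \<Rightarrow> formula) \<Rightarrow> bool" where
  "atom_subst \<sigma> \<tau> g \<longleftrightarrow> (\<forall>\<alpha>. atomic \<alpha> \<and> MSO \<sigma> \<alpha> \<longrightarrow>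
     qfree (g \<alpha>) \<and> MSO \<tau> (g \<alpha>) \<and> fv1 (g \<alpha>) = fv1 \<alpha> \<and> fv2 (g \<alpha>) = fv2 \<alpha>)"

lemma map_atoms_props:
  assumes "atom_subst \<sigma> \<tau> g" "MSO \<sigma> \<phi>"
  shows "MSO \<tau> (map_atoms g \<phi>)" "fv1 (map_atoms g \<phi>) = fv1 \<phi>" "fv2 (map_atoms g \<phi>) = fv2 \<phi>"
    "qfree \<phi> \<Longrightarrow> qfree (map_atoms g \<phi>)"
proof -
  have "MSO \<tau> (map_atoms g \<phi>) \<and> fv1 (map_atoms g \<phi>) = fv1 \<phi> \<and> fv2 (map_atoms g \<phi>) = fv2 \<phi> \<and>
    (qfree \<phi> \<longrightarrow> qfree (map_atoms g \<phi>))"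
    using assms by (induction \<phi>) (auto simp: atom_subst_def)
  then show "MSO \<tau> (map_atoms g \<phi>)" "fv1 (map_atoms g \<phi>) = fv1 \<phi>"
    "fv2 (map_atoms g \<phi>) = fv2 \<phi>" "qfree \<phi> \<Longrightarrow> qfree (map_atoms g \<phi>)" by auto
qed

section \<open>Substitution steps, their chains, and closure of enrichments\<close>

lemma qf_subst_preserves:
  assumes "qf_subst \<tau> \<phi> \<phi>'"
  shows "fv1 \<phi>' = fv1 \<phi>" "fv2 \<phi>' = fv2 \<phi>" "MSO \<tau> \<phi> \<Longrightarrow> MSO \<tau> \<phi>'"
  using assms by (induction) auto

lemma MSO_mono: "MSO \<sigma> \<phi> \<Longrightarrow> \<sigma> \<subseteq> \<tau> \<Longrightarrow> MSO \<tau> \<phi>"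
  by (induction \<phi>) auto

lemma qf_subst_mono: "qf_subst \<sigma> \<phi> \<phi>' \<Longrightarrow> \<sigma> \<subseteq> \<tau> \<Longrightarrow> qf_subst \<tau> \<phi> \<phi>'"
  by (induction rule: qf_subst.induct) (auto intro: qf_subst.intros MSO_mono)

text \<open>An atom map keeps quantifier-freeness and free variables, so it carries a substitution
  step to a substitution step; derivations can thus be translated step by step.\<close>

lemma qf_subst_map_atoms:
  assumes "qf_subst \<sigma> \<phi> \<phi>'" "MSO \<sigma> \<phi>" "atom_subst \<sigma> \<tau> g"
  shows "qf_subst \<tau> (map_atoms g \<phi>) (map_atoms g \<phi>')"
  using assms by (induction) (auto intro!: qf_subst.intros simp: map_atoms_props)

lemma rtranclp_map:
  assumes "r\<^sup>*\<^sup>* x y" "\<And>x y. r x y \<Longrightarrow> r (f x) (f y)"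
  shows "r\<^sup>*\<^sup>* (f x) (f y)"
  using assms(1) by induction (auto intro: rtranclp.rtrancl_into_rtrancl assms(2))

lemma rtranclp_map2:
  assumes "r\<^sup>*\<^sup>* x y" "r\<^sup>*\<^sup>* x' y'"
    and "\<And>x y z. r x y \<Longrightarrow> r (f x z) (f y z)" "\<And>x y z. r x y \<Longrightarrow> r (f z x) (f z y)"
  shows "r\<^sup>*\<^sup>* (f x x') (f y y')"
  using rtranclp_map[OF assms(1), of "\<lambda>x. f x x'"] rtranclp_map[OF assms(2), of "f y"] assms(3,4)
  by (meson rtranclp_trans)

text \<open>A step of \<open>qf_subst\<close> touches one occurrence, so replacing all atoms takes a
  chain of steps, run in one component of a connective after the other.\<close>

lemma map_atoms_reachable:
  assumes "atom_subst \<sigma> \<tau> g" "MSO \<sigma> \<phi>"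
  shows "(qf_subst \<tau>)\<^sup>*\<^sup>* \<phi> (map_atoms g \<phi>)"
  using assms(2)
proof (induction \<phi>)
  case (Conj \<phi> \<psi>)
  then show ?case by (auto intro!: rtranclp_map2[where f = Conj] qf_subst.Conj1 qf_subst.Conj2)
next
  case (Disj \<phi> \<psi>)
  then show ?case by (auto intro!: rtranclp_map2[where f = Disj] qf_subst.Disj1 qf_subst.Disj2)
next
  case (Neg \<phi>)
  then show ?case by (auto intro!: rtranclp_map[where f = Neg] qf_subst.Neg)
next
  case (Ex1 x \<phi>)
  then show ?case by (auto intro!: rtranclp_map[where f = "Ex1 x"] qf_subst.Ex1)
next
  case (All1 x \<phi>)
  then show ?case by (auto intro!: rtranclp_map[where f = "All1 x"] qf_subst.All1)
next
  case (Ex2 x \<phi>)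
  then show ?case by (auto intro!: rtranclp_map[where f = "Ex2 x"] qf_subst.Ex2)
next
  case (All2 x \<phi>)
  then show ?case by (auto intro!: rtranclp_map[where f = "All2 x"] qf_subst.All2)
qed (use assms(1) in \<open>auto simp: atom_subst_def intro!: r_into_rtranclp qf_subst.here\<close>)

lemma enrich_reachable:
  assumes "(qf_subst (\<sigma> \<union> \<sigma>'))\<^sup>*\<^sup>* \<phi> \<psi>" "\<phi> \<in> enrich \<sigma> F \<sigma>'"
  shows "\<psi> \<in> enrich \<sigma> F \<sigma>'"
  using assms by induction (auto intro: enrich.subst)

lemma fragmentD:
  assumes "fragment \<sigma> F"
  shows "\<phi> \<in> F \<Longrightarrow> closed_formula \<phi>" "\<phi> \<in> F \<Longrightarrow> MSO \<sigma> \<phi>"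
    and "\<phi> \<in> F \<Longrightarrow> \<psi> \<in> F \<Longrightarrow> Conj \<phi> \<psi> \<in> F" "\<phi> \<in> F \<Longrightarrow> \<psi> \<in> F \<Longrightarrow> Disj \<phi> \<psi> \<in> F"
    and "\<phi> \<in> F \<Longrightarrow> qf_subst \<sigma> \<phi> \<phi>' \<Longrightarrow> \<phi>' \<in> F"
    and "closed_formula \<phi> \<Longrightarrow> MSO \<sigma> \<phi> \<Longrightarrow> qfree \<phi> \<Longrightarrow> \<phi> \<in> F"
  using assms unfolding fragment_def by blast+

lemma fragment_reachable:
  assumes "(qf_subst \<sigma>)\<^sup>*\<^sup>* \<phi> \<psi>" "\<phi> \<in> F" "fragment \<sigma> F"
  shows "\<psi> \<in> F"
  using assms(1,2) by induction (auto intro: fragmentD[OF assms(3)])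

lemma enrich_mono: "\<phi> \<in> enrich \<sigma> F \<tau> \<Longrightarrow> \<tau> \<subseteq> \<tau>' \<Longrightarrow> \<phi> \<in> enrich \<sigma> F \<tau>'"
  by (induction rule: enrich.induct)
    (auto intro: enrich.base enrich.subst qf_subst_mono)

lemma enrich_wf:
  assumes "\<phi> \<in> enrich \<sigma> F \<sigma>'" "fragment \<sigma> F"
  shows "MSO (\<sigma> \<union> \<sigma>') \<phi>" "closed_formula \<phi>"
proof -
  have "MSO (\<sigma> \<union> \<sigma>') \<phi> \<and> closed_formula \<phi>"
    using assms
  proof induction
    case (base \<phi>)
    then show ?case using fragmentD MSO_mono by (metis Un_upper1)
  next
    case (subst \<phi> \<phi>')
    then show ?case using qf_subst_preserves[OF subst(2)] by (auto simp: closed_formula_def)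
  qed
  then show "MSO (\<sigma> \<union> \<sigma>') \<phi>" "closed_formula \<phi>" by auto
qed

lemma enrich_cases_reachable:
  assumes "\<phi> \<in> enrich \<sigma> F \<sigma>'"
  obtains \<phi>\<^sub>0 where "\<phi>\<^sub>0 \<in> F" "(qf_subst (\<sigma> \<union> \<sigma>'))\<^sup>*\<^sup>* \<phi>\<^sub>0 \<phi>"
proof -
  have "\<exists>\<phi>\<^sub>0\<in>F. (qf_subst (\<sigma> \<union> \<sigma>'))\<^sup>*\<^sup>* \<phi>\<^sub>0 \<phi>"
    using assms by induction (auto intro: rtranclp.rtrancl_into_rtrancl)
  then show ?thesis using that by blast
qed

text \<open>The enrichment is generated by substitutions alone. The formulas of \<open>F\<close>
  from which \<phi> and \<psi> are derived are first joined inside \<open>F\<close>; both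
  derivations are then run inside the joined formula.\<close>

lemma enrich_Conj_Disj:
  assumes "\<phi> \<in> enrich \<sigma> F \<sigma>'" "\<psi> \<in> enrich \<sigma> F \<sigma>'" "fragment \<sigma> F"
  shows "Conj \<phi> \<psi> \<in> enrich \<sigma> F \<sigma>'" "Disj \<phi> \<psi> \<in> enrich \<sigma> F \<sigma>'"
proof -
  obtain \<phi>\<^sub>0 \<psi>\<^sub>0 where *: "\<phi>\<^sub>0 \<in> F" "(qf_subst (\<sigma> \<union> \<sigma>'))\<^sup>*\<^sup>* \<phi>\<^sub>0 \<phi>"
      "\<psi>\<^sub>0 \<in> F" "(qf_subst (\<sigma> \<union> \<sigma>'))\<^sup>*\<^sup>* \<psi>\<^sub>0 \<psi>"
    using assms by (metis enrich_cases_reachable)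
  have "(qf_subst (\<sigma> \<union> \<sigma>'))\<^sup>*\<^sup>* (Conj \<phi>\<^sub>0 \<psi>\<^sub>0) (Conj \<phi> \<psi>)"
    by (rule rtranclp_map2[where f = Conj, OF *(2,4)]) (auto intro: qf_subst.intros)
  moreover have "(qf_subst (\<sigma> \<union> \<sigma>'))\<^sup>*\<^sup>* (Disj \<phi>\<^sub>0 \<psi>\<^sub>0) (Disj \<phi> \<psi>)"
    by (rule rtranclp_map2[where f = Disj, OF *(2,4)]) (auto intro: qf_subst.intros)
  moreover have "Conj \<phi>\<^sub>0 \<psi>\<^sub>0 \<in> F" "Disj \<phi>\<^sub>0 \<psi>\<^sub>0 \<in> F"
    using fragmentD(3,4)[OF assms(3)] *(1,3) by auto
  ultimately show "Conj \<phi> \<psi> \<in> enrich \<sigma> F \<sigma>'" "Disj \<phi> \<psi> \<in> enrich \<sigma> F \<sigma>'"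
    by (auto intro: enrich_reachable enrich.base)
qed

text \<open>A closed quantifier-free formula is a single substitution away from \<open>Tr\<close>,
  which has no free variables either.\<close>

lemma enrich_qfree:
  assumes "qfree \<psi>" "MSO (\<sigma> \<union> \<sigma>') \<psi>" "closed_formula \<psi>" "fragment \<sigma> F"
  shows "\<psi> \<in> enrich \<sigma> F \<sigma>'"
proof (rule enrich.subst[OF enrich.base])
  show "Tr \<in> F" using fragmentD(6)[OF assms(4)] by (simp add: closed_formula_def)
  show "qf_subst (\<sigma> \<union> \<sigma>') Tr \<psi>"
    using assms by (auto intro!: qf_subst.here simp: closed_formula_def)
qed

section \<open>Words annotated with positions modulo d\<close>

text \<open>A letter and a residue are coded as one number and recovered by \<open>div d\<close> and
  \<open>mod d\<close>. The offset \<open>i\<close> makes annotation compatible with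
  concatenation.\<close>

fun annotate :: "nat \<Rightarrow> nat \<Rightarrow> nat list \<Rightarrow> nat list" where
  "annotate d i [] = []"
| "annotate d i (a # w) = (a * d + i mod d) # annotate d (Suc i) w"

definition annotated_alphabet :: "nat \<Rightarrow> nat set \<Rightarrow> nat set" where
  "annotated_alphabet d A = (\<lambda>(a, i). a * d + i) ` (A \<times> {..<d})"

lemma length_annotate [simp]: "length (annotate d i w) = length w"
  by (induction w arbitrary: i) auto

lemma nth_annotate: "k < length w \<Longrightarrow> annotate d i w ! k = w ! k * d + (i + k) mod d"
  by (induction w arbitrary: i k) (auto simp: nth_Cons split: nat.split)

lemma annotate_append: "annotate d i (u @ v) = annotate d i u @ annotate d (i + length u) v"
  by (induction u arbitrary: i) auto

lemma annotate_mod: "annotate d (i mod d) w = annotate d i w"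
  by (rule nth_equalityI) (auto simp: nth_annotate mod_add_left_eq)

lemma finite_annotated_alphabet: "finite A \<Longrightarrow> finite (annotated_alphabet d A)"
  by (auto simp: annotated_alphabet_def)

lemma annotate_in_lists: "d > 0 \<Longrightarrow> w \<in> lists A \<Longrightarrow> annotate d i w \<in> lists (annotated_alphabet d A)"
  by (induction w arbitrary: i) (auto simp: annotated_alphabet_def image_iff intro!: bexI)

text \<open>The contradiction at the end keeps \<open>x\<close> free even for the empty list;
  \<open>Fa\<close> would lose the variable, which substitutions must preserve.\<close>

definition any_letter :: "nat list \<Rightarrow> nat \<Rightarrow> formula" where
  "any_letter as x =
     foldr (\<lambda>a. Disj (Letter a x)) as (Conj (Letter 0 x) (Neg (Letter 0 x)))"

lemma any_letter_simps [simp]: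
  "fv1 (any_letter as x) = {x}" "fv2 (any_letter as x) = {}" "qfree (any_letter as x)"
  "MSO \<sigma> (any_letter as x)"
  "sat w v V (any_letter as x) \<longleftrightarrow> v x < length w \<and> w ! v x \<in> set as"
  unfolding any_letter_def by (induction as) auto

text \<open>Unlike \<open>MOD_at d\<close>, this semantic version is monotone in \<open>d\<close> for divisibility, so that the
  moduli occurring in a formula can be replaced by a common multiple.\<close>

definition periodic :: "nat \<Rightarrow> num_pred set" where
  "periodic d = {p. arity p = 0 \<and> (\<forall>n. rel p n [] = rel p (n mod d) []) \<or>
     arity p = 1 \<and> (\<forall>n x. rel p n [x] = rel p 0 [x mod d])}"

text \<open>A modular predicate of one argument becomes the disjunction of the annotated letters
  with an admissible residue. A constant is evaluated at the residue \<open>r\<close> of the word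
  length, hence one translation for each \<open>r\<close>.\<close>

definition to_annotation :: "num_pred set \<Rightarrow> nat list \<Rightarrow> nat \<Rightarrow> nat \<Rightarrow> formula \<Rightarrow> formula" where
  "to_annotation \<sigma> as d r \<alpha> = (case \<alpha> of
     Letter a x \<Rightarrow> any_letter (map (\<lambda>j. a * d + j) [0..<d]) x
   | Pred p xs \<Rightarrow>
       if p \<in> \<sigma> then Pred p xs
       else if arity p = 0 then (if rel p r [] then Tr else Fa)
       else any_letter [a * d + j. a \<leftarrow> as, j \<leftarrow> [0..<d], rel p 0 [j]] (hd xs)
   | _ \<Rightarrow> \<alpha>)"

lemma atom_subst_to_annotation:
  assumes "\<And>p. p \<in> \<sigma>' \<Longrightarrow> arity p \<le> 1"
  shows "atom_subst (\<sigma> \<union> \<sigma>') \<sigma> (to_annotation \<sigma> as d r)"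
  unfolding atom_subst_def
proof (intro allI impI, elim conjE)
  fix \<alpha> assume "atomic \<alpha>" "MSO (\<sigma> \<union> \<sigma>') \<alpha>"
  then show "qfree (to_annotation \<sigma> as d r \<alpha>) \<and> MSO \<sigma> (to_annotation \<sigma> as d r \<alpha>) \<and>
    fv1 (to_annotation \<sigma> as d r \<alpha>) = fv1 \<alpha> \<and> fv2 (to_annotation \<sigma> as d r \<alpha>) = fv2 \<alpha>"
  proof (cases \<alpha>)
    case (Pred p xs)
    show ?thesis
    proof (cases "p \<in> \<sigma> \<or> arity p = 0")
      case True
      then show ?thesis using Pred \<open>MSO _ \<alpha>\<close> by (auto simp: to_annotation_def)
    next
      case False
      then have "arity p = 1" using assms[of p] Pred \<open>MSO _ \<alpha>\<close> by auto
      then obtain x where "xs = [x]" using Pred \<open>MSO _ \<alpha>\<close> by (auto simp: length_Suc_conv)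
      then show ?thesis using Pred False by (auto simp: to_annotation_def)
    qed
  qed (auto simp: to_annotation_def)
qed

text \<open>Induction on the derivation: a formula of \<open>F\<close> is rewritten by a chain of
  substitutions over \<open>\<sigma>\<close>, and each later step becomes a step over
  \<open>\<sigma>\<close>; \<open>F\<close> is closed under both.\<close>

lemma enrich_to_annotation:
  assumes "\<phi> \<in> enrich \<sigma> F \<sigma>'" "fragment \<sigma> F" "\<And>p. p \<in> \<sigma>' \<Longrightarrow> arity p \<le> 1"
  shows "map_atoms (to_annotation \<sigma> as d r) \<phi> \<in> F"
  using assms(1)
proof induction
  case (base \<phi>)
  have "atom_subst (\<sigma> \<union> {}) \<sigma> (to_annotation \<sigma> as d r)"
    by (rule atom_subst_to_annotation) auto
  moreover have "MSO \<sigma> \<phi>" using base fragmentD(2)[OF assms(2)] by blast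
  ultimately show ?case
    using fragment_reachable[OF map_atoms_reachable base assms(2)] by simp
next
  case (subst \<phi> \<phi>')
  have "MSO (\<sigma> \<union> \<sigma>') \<phi>" using enrich_wf subst assms(2) by blast
  then have "qf_subst \<sigma> (map_atoms (to_annotation \<sigma> as d r) \<phi>) (map_atoms (to_annotation \<sigma> as d r) \<phi>')"
    using qf_subst_map_atoms[OF subst(2)] atom_subst_to_annotation assms(3) by blast
  then show ?case using subst fragmentD(5)[OF assms(2)] by blast
qed

lemma annotated_letter:
  assumes "k < length w" "d > 0" "j < d"
  shows "annotate d 0 w ! k = a * d + j \<longleftrightarrow> w ! k = a \<and> k mod d = j"
proof -
  have "annotate d 0 w ! k = w ! k * d + k mod d" using assms(1) by (simp add: nth_annotate)
  moreover have "(w ! k * d + k mod d) div d = w ! k" "(w ! k * d + k mod d) mod d = k mod d"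
    "(a * d + j) div d = a" "(a * d + j) mod d = j"
    using assms(2,3) by simp_all
  ultimately show ?thesis by metis
qed

text \<open>Free variables denote positions inside the word, where the annotated letter reveals both
  the letter and the residue of the position. Annotation keeps the length, so predicates of
  \<open>\<sigma>\<close> keep their value.\<close>

lemma sat_to_annotation:
  assumes "MSO (\<sigma> \<union> periodic d) \<phi>" "d > 0" "w \<in> lists (set as)"
    and "\<And>x. x \<in> fv1 \<phi> \<Longrightarrow> v x < length w"
  shows "sat (annotate d 0 w) v V (map_atoms (to_annotation \<sigma> as d (length w mod d)) \<phi>) \<longleftrightarrow> sat w v V \<phi>"
  using assms(1,4)
proof (induction \<phi> arbitrary: v V)
  case (Letter a x)
  have "annotate d 0 w ! v x \<in> set (map (\<lambda>j. a * d + j) [0..<d]) \<longleftrightarrow>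
      (\<exists>j<d. annotate d 0 w ! v x = a * d + j)"
    by (simp only: set_map image_iff) auto
  also have "\<dots> \<longleftrightarrow> w ! v x = a" if "v x < length w"
    using annotated_letter[OF that \<open>d > 0\<close>] \<open>d > 0\<close> by (metis mod_less_divisor)
  finally show ?case by (auto simp: to_annotation_def)
next
  case (Pred p xs)
  show ?case
  proof (cases "p \<in> \<sigma>")
    case False
    then have p: "p \<in> periodic d" "length xs = arity p" using Pred by auto
    show ?thesis
    proof (cases "arity p = 0")
      case True
      then show ?thesis using p False by (auto simp: to_annotation_def periodic_def)
    next
      case nz: False
      then have "arity p = 1" using p by (auto simp: periodic_def)
      then obtain x where x: "xs = [x]" using p by (auto simp: length_Suc_conv)
      have vx: "v x < length w" using Pred x by auto
      then have "w ! v x \<in> set as" using assms(3) by (auto simp: in_lists_conv_set)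
      have "set [a * d + j. a \<leftarrow> as, j \<leftarrow> [0..<d], rel p 0 [j]] =
          {a * d + j |a j. a \<in> set as \<and> j < d \<and> rel p 0 [j]}"
        by fastforce
      then have "annotate d 0 w ! v x \<in> set [a * d + j. a \<leftarrow> as, j \<leftarrow> [0..<d], rel p 0 [j]] \<longleftrightarrow>
          (\<exists>a\<in>set as. \<exists>j<d. rel p 0 [j] \<and> annotate d 0 w ! v x = a * d + j)"
        by (simp only: mem_Collect_eq) blast
      also have "\<dots> \<longleftrightarrow> rel p 0 [v x mod d]"
        using \<open>w ! v x \<in> set as\<close> annotated_letter[OF vx \<open>d > 0\<close>] \<open>d > 0\<close>
        by (metis mod_less_divisor)
      finally show ?thesis using False nz x vx p by (auto simp: to_annotation_def periodic_def)
    qed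
  qed (auto simp: to_annotation_def)
next
  case (Ex1 x \<phi>)
  have "sat (annotate d 0 w) (v(x := i)) V (map_atoms (to_annotation \<sigma> as d (length w mod d)) \<phi>) \<longleftrightarrow> 
    sat w (v(x := i)) V \<phi>" if "i < length w" for i
    using Ex1 that by auto
  then show ?case by auto
next
  case (All1 x \<phi>)
  have "sat (annotate d 0 w) (v(x := i)) V (map_atoms (to_annotation \<sigma> as d (length w mod d)) \<phi>) \<longleftrightarrow> 
    sat w (v(x := i)) V \<phi>" if "i < length w" for i
    using All1 that by auto
  then show ?case by auto
qed (auto simp: to_annotation_def)

section \<open>A common modulus for all modular predicates of a formula\<close>

lemma periodic_mult: "periodic d \<subseteq> periodic (d * e)"
proof
  fix p assume p: "p \<in> periodic d"
  have mod: "n mod (d * e) mod d = n mod d" for n by (simp add: mod_mod_cancel)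
  consider "arity p = 0" "\<forall>n. rel p n [] = rel p (n mod d) []"
    | "arity p = 1" "\<forall>n x. rel p n [x] = rel p 0 [x mod d]"
    using p by (auto simp only: periodic_def mem_Collect_eq)
  then show "p \<in> periodic (d * e)"
  proof cases
    case 1
    then have "\<forall>n. rel p n [] = rel p (n mod (d * e)) []" by (metis mod)
    then show ?thesis using 1(1) unfolding periodic_def by blast
  next
    case 2
    then have "\<forall>n x. rel p n [x] = rel p 0 [x mod (d * e)]" by (metis mod)
    then show ?thesis using 2(1) unfolding periodic_def by blast
  qed
qed

lemma MOD_at_periodic: "MOD_at d \<subseteq> periodic d"
  by (auto simp: MOD_at_def periodic_def mod_pred_def mod_const_def)

lemma MSO_MOD_periodic:
  assumes "MSO (\<sigma> \<union> MOD) \<phi>"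
  shows "\<exists>d>0. MSO (\<sigma> \<union> periodic d) \<phi>"
proof -
  \<comment> \<open>The product of the moduli of two subformulas is a common multiple.\<close>
  have two: "\<exists>d>0. MSO (\<sigma> \<union> periodic d) \<phi> \<and> MSO (\<sigma> \<union> periodic d) \<psi>"
    if "\<exists>d>0. MSO (\<sigma> \<union> periodic d) \<phi>" "\<exists>d>0. MSO (\<sigma> \<union> periodic d) \<psi>" for \<phi> \<psi>
  proof -
    obtain d e where "d > 0" "e > 0" "MSO (\<sigma> \<union> periodic d) \<phi>" "MSO (\<sigma> \<union> periodic e) \<psi>"
      using \<open>\<exists>d>0. MSO (\<sigma> \<union> periodic d) \<phi>\<close> \<open>\<exists>d>0. MSO (\<sigma> \<union> periodic d) \<psi>\<close> by blast
    moreover have "\<sigma> \<union> periodic d \<subseteq> \<sigma> \<union> periodic (d * e)" "\<sigma> \<union> periodic e \<subseteq> \<sigma> \<union> periodic (d * e)"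
      using periodic_mult[of d e] periodic_mult[of e d] by (auto simp: mult.commute)
    ultimately show ?thesis
      by (metis MSO_mono mult_pos_pos)
  qed
  show ?thesis
    using assms
  proof (induction \<phi>)
    case (Pred p xs)
    show ?case
    proof (cases "p \<in> \<sigma>")
      case False
      then have "p \<in> MOD" using Pred by simp
      then obtain d where "d \<in> {1..}" "p \<in> MOD_at d" unfolding MOD_def by blast
      then have "d > 0" "p \<in> periodic d" using MOD_at_periodic by auto
      then show ?thesis using Pred by auto
    qed (use Pred in auto)
  next
    case (Conj \<phi> \<psi>)
    then show ?case using two[of \<phi> \<psi>] by auto
  next
    case (Disj \<phi> \<psi>)
    then show ?case using two[of \<phi> \<psi>] by auto
  qed auto
qed

section \<open>Translating annotated letters back into modular predicates\<close>

definition from_annotation :: "nat \<Rightarrow> formula \<Rightarrow> formula" where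
  "from_annotation d \<alpha> = (case \<alpha> of
     Letter c x \<Rightarrow> Conj (Letter (c div d) x) (Pred (mod_pred d (c mod d)) [x])
   | _ \<Rightarrow> \<alpha>)"

lemma mod_pred_simps [simp]:
  "arity (mod_pred d i) = 1" "rel (mod_pred d i) n xs \<longleftrightarrow> hd xs mod d = i"
  "arity (mod_const d i) = 0" "rel (mod_const d i) n xs \<longleftrightarrow> n mod d = i"
  by (auto simp: mod_pred_def mod_const_def)

lemma atom_subst_from_annotation:
  assumes "d > 0"
  shows "atom_subst \<sigma> (\<sigma> \<union> MOD_at d) (from_annotation d)"
  unfolding atom_subst_def
proof (intro allI impI, elim conjE)
  fix \<alpha> assume "atomic \<alpha>" "MSO \<sigma> \<alpha>"
  then show "qfree (from_annotation d \<alpha>) \<and> MSO (\<sigma> \<union> MOD_at d) (from_annotation d \<alpha>) \<and>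
    fv1 (from_annotation d \<alpha>) = fv1 \<alpha> \<and> fv2 (from_annotation d \<alpha>) = fv2 \<alpha>"
    using assms by (cases \<alpha>) (auto simp: from_annotation_def MOD_at_def)
qed

lemma from_annotation_enrich:
  assumes "\<phi> \<in> F" "fragment \<sigma> F" "d > 0"
  shows "map_atoms (from_annotation d) \<phi> \<in> enrich \<sigma> F (MOD_at d)"
proof -
  have "MSO \<sigma> \<phi>" using assms fragmentD(2) by blast
  then show ?thesis
    using map_atoms_reachable[OF atom_subst_from_annotation] enrich_reachable enrich.base assms
    by metis
qed

text \<open>Only letters need translating: \<open>w\<close> and its annotation have the same
  positions and length, so all other atoms agree.\<close>

lemma sat_from_annotation:
  assumes "d > 0"
  shows "sat w v V (map_atoms (from_annotation d) \<phi>) \<longleftrightarrow> sat (annotate d 0 w) v V \<phi>"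
proof (induction \<phi> arbitrary: v V)
  case (Letter c x)
  have "annotate d 0 w ! v x = c \<longleftrightarrow> w ! v x = c div d \<and> v x mod d = c mod d" if "v x < length w"
    using annotated_letter[OF that assms, of "c mod d" "c div d"] assms by simp
  then show ?case by (auto simp: from_annotation_def)
qed (auto simp: from_annotation_def)

section \<open>Varieties of monoids\<close>

lemma monoid_varietyD:
  assumes "monoid_variety \<V>"
  shows "\<V> \<noteq> {}" "M \<in> \<V> \<Longrightarrow> monoid M" "M \<in> \<V> \<Longrightarrow> finite (carrier M)"
    "M \<in> \<V> \<Longrightarrow> monoid N \<Longrightarrow> monoid_divides N M \<Longrightarrow> N \<in> \<V>"
    "M \<in> \<V> \<Longrightarrow> N \<in> \<V> \<Longrightarrow> belongs (M \<times>\<times> N) \<V>"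
  using assms unfolding monoid_variety_def by blast+

lemma free_monoid_simps [simp]:
  "carrier (free_monoid A) = lists A" "monoid.mult (free_monoid A) = (@)" "one (free_monoid A) = []"
  by (auto simp: free_monoid_def)

lemma free_morphism_iff:
  "monoid_morphism (free_monoid A) M h \<longleftrightarrow>
    (\<forall>u\<in>lists A. h u \<in> carrier M) \<and> (\<forall>u\<in>lists A. \<forall>v\<in>lists A. h (u @ v) = h u \<otimes>\<^bsub>M\<^esub> h v) \<and>
    h [] = \<one>\<^bsub>M\<^esub>"
  by (auto simp: monoid_morphism_def hom_def)

text \<open>\<open>iso\<close> asks only for a multiplicative bijection. Surjectivity supplies a
  preimage of the unit of \<open>N\<close>; multiplying it by the unit of \<open>M\<close> shows
  that the unit goes to the unit.\<close>

lemma iso_one: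
  assumes "f \<in> iso M N" "monoid M" "monoid N"
  shows "f \<one>\<^bsub>M\<^esub> = \<one>\<^bsub>N\<^esub>"
proof -
  interpret M: monoid M by fact
  interpret N: monoid N by fact
  have f: "f \<in> hom M N" "bij_betw f (carrier M) (carrier N)" using assms(1) by (auto simp: iso_def)
  then obtain x where x: "x \<in> carrier M" "f x = \<one>\<^bsub>N\<^esub>"
    by (metis N.one_closed bij_betw_imp_surj_on imageE)
  have "f \<one>\<^bsub>M\<^esub> \<in> carrier N" using f(1) by (auto simp: hom_def)
  moreover have "f (\<one>\<^bsub>M\<^esub> \<otimes>\<^bsub>M\<^esub> x) = f \<one>\<^bsub>M\<^esub> \<otimes>\<^bsub>N\<^esub> f x" using f(1) x(1)
    by (intro hom_mult) auto
  ultimately show ?thesis using x by simp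
qed

lemma free_morphism_iso:
  assumes "monoid_morphism (free_monoid A) M h" "f \<in> iso M N" "monoid M" "monoid N"
  shows "monoid_morphism (free_monoid A) N (f \<circ> h)"
proof -
  have "f \<in> hom M N" using assms(2) by (simp add: iso_def)
  then show ?thesis
    using assms(1) iso_one[OF assms(2-4)] by (auto simp: free_morphism_iff hom_def)
qed

text \<open>Varieties consist of monoids of naturals, so a finite monoid over another type is
  renamed through an injective numbering before it can be a member.\<close>

lemma finite_monoid_copy:
  assumes "monoid M" "finite (carrier M)"
  obtains N :: "nat monoid" and f where "f \<in> iso M N" "monoid N"
proof -
  interpret monoid M by fact
  obtain e :: "'a \<Rightarrow> nat" where e: "inj_on e (carrier M)"
    using assms(2) finite_imp_inj_to_nat_seg by blast
  define d where "d = the_inv_into (carrier M) e"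
  have d: "d (e x) = x" if "x \<in> carrier M" for x
    using that e by (simp add: d_def the_inv_into_f_f)
  define N where "N = \<lparr>carrier = e ` carrier M, monoid.mult = (\<lambda>x y. e (d x \<otimes>\<^bsub>M\<^esub> d y)), one = e \<one>\<^bsub>M\<^esub>\<rparr>"
  have "monoid N"
    by (rule monoidI) (auto simp: N_def d m_assoc)
  moreover have "e \<in> iso M N"
    using e by (auto simp: N_def iso_def hom_def d bij_betw_def)
  ultimately show ?thesis using that by blast
qed

text \<open>The morphisms are merged into their tuple. As the variety is closed under binary
  products up to isomorphism, factors are added one at a time; the empty family is served by a
  constant morphism into any member.\<close>

lemma variety_joint_morphism:
  assumes \<V>: "monoid_variety \<V>" and "finite I"
    and "\<And>i. i \<in> I \<Longrightarrow> N i \<in> \<V> \<and> monoid_morphism (free_monoid B) (N i) (h i)"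
  shows "\<exists>M\<in>\<V>. \<exists>g. monoid_morphism (free_monoid B) M g \<and>
    (\<forall>u\<in>lists B. \<forall>v\<in>lists B. g u = g v \<longrightarrow> (\<forall>i\<in>I. h i u = h i v))"
  using assms(2,3)
proof (induction I rule: finite_induct)
  case empty
  obtain M where "M \<in> \<V>" using monoid_varietyD(1)[OF \<V>] by blast
  then interpret monoid M using monoid_varietyD(2)[OF \<V>] by blast
  have "monoid_morphism (free_monoid B) M (\<lambda>_. \<one>\<^bsub>M\<^esub>)" by (simp add: free_morphism_iff)
  then show ?case using \<open>M \<in> \<V>\<close> by blast
next
  case (insert i I)
  then obtain M g where M: "M \<in> \<V>" "monoid_morphism (free_monoid B) M g"
    "\<forall>u\<in>lists B. \<forall>v\<in>lists B. g u = g v \<longrightarrow> (\<forall>i\<in>I. h i u = h i v)" by (metis insertCI)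
  have i: "N i \<in> \<V>" "monoid_morphism (free_monoid B) (N i) (h i)" using insert by auto
  obtain P f where P: "P \<in> \<V>" "f \<in> iso (M \<times>\<times> N i) P"
    using monoid_varietyD(5)[OF \<V> M(1) i(1)] by (auto simp: belongs_def is_iso_def)
  have mon: "monoid (M \<times>\<times> N i)" "monoid P"
    using monoid_varietyD(2)[OF \<V>] M(1) i(1) P(1) by (auto intro: DirProd_monoid)
  have "monoid_morphism (free_monoid B) (M \<times>\<times> N i) (\<lambda>u. (g u, h i u))"
    using M(2) i(2) by (auto simp: free_morphism_iff)
  then have "monoid_morphism (free_monoid B) P (f \<circ> (\<lambda>u. (g u, h i u)))"
    using P(2) mon by (rule free_morphism_iso)
  moreover have "g u = g v \<and> h i u = h i v"
    if "(f \<circ> (\<lambda>u. (g u, h i u))) u = (f \<circ> (\<lambda>u. (g u, h i u))) v" "u \<in> lists B" "v \<in> lists B" for u v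
  proof -
    have "inj_on f (carrier (M \<times>\<times> N i))" using P(2) by (auto simp: iso_def bij_betw_def)
    moreover have "(g u, h i u) \<in> carrier (M \<times>\<times> N i)" "(g v, h i v) \<in> carrier (M \<times>\<times> N i)"
      using that M(2) i(2) by (auto simp: free_morphism_iff)
    ultimately show ?thesis using that by (auto dest: inj_onD)
  qed
  ultimately have "\<forall>u\<in>lists B. \<forall>v\<in>lists B.
      (f \<circ> (\<lambda>u. (g u, h i u))) u = (f \<circ> (\<lambda>u. (g u, h i u))) v \<longrightarrow> (\<forall>j\<in>insert i I. h j u = h j v)"
    using M(3) by blast
  then show ?case
    using P(1) \<open>monoid_morphism (free_monoid B) P (f \<circ> (\<lambda>u. (g u, h i u)))\<close> by blast
qed

text \<open>By \<open>sep\<close>, the kernel of the joint morphism lies in the kernel of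
  \<open>\<mu>\<close>. Hence \<open>S\<close>, the image of \<open>\<mu>\<close>, is a quotient of
  the image of the joint morphism, which is a submonoid of a member.\<close>

lemma belongs_variety_of_morphisms:
  assumes \<V>: "monoid_variety \<V>" and "finite I"
    and h: "\<And>i. i \<in> I \<Longrightarrow> N i \<in> \<V> \<and> monoid_morphism (free_monoid B) (N i) (h i)"
    and S: "monoid S" "monoid_morphism (free_monoid B) S \<mu>" "carrier S = \<mu> ` lists B"
    and sep: "\<And>u v. u \<in> lists B \<Longrightarrow> v \<in> lists B \<Longrightarrow> (\<And>i. i \<in> I \<Longrightarrow> h i u = h i v) \<Longrightarrow> \<mu> u = \<mu> v"
  shows "belongs S \<V>"
proof -
  have "\<exists>M\<in>\<V>. \<exists>g. monoid_morphism (free_monoid B) M g \<and>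
      (\<forall>u\<in>lists B. \<forall>v\<in>lists B. g u = g v \<longrightarrow> (\<forall>i\<in>I. h i u = h i v))"
    using \<V> \<open>finite I\<close> h by (rule variety_joint_morphism)
  then obtain M g where M: "M \<in> \<V>" "monoid_morphism (free_monoid B) M g"
    and g: "\<forall>u\<in>lists B. \<forall>v\<in>lists B. g u = g v \<longrightarrow> (\<forall>i\<in>I. h i u = h i v)" by blast
  have \<mu>: "\<mu> u = \<mu> v" if "u \<in> lists B" "v \<in> lists B" "g u = g v" for u v
    by (rule sep) (use that g in blast)+
  \<comment> \<open>\<open>\<mu>\<close> is constant on the fibres of \<open>g\<close>, so it
    factors through \<open>g\<close>; the factor \<open>k\<close> yields the surjection of the
    division.\<close>
  have "\<exists>k. \<forall>u. u \<in> lists B \<longrightarrow> \<mu> u = k (g u)"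
    using function_factors_left_gen[of "\<lambda>u. u \<in> lists B" g \<mu>] \<mu> by blast
  then obtain k where k: "\<And>u. u \<in> lists B \<Longrightarrow> k (g u) = \<mu> u" by fastforce
  have kg: "carrier S = k ` g ` lists B" using S(3) k by (auto simp: image_iff)
  have "g ` lists B \<subseteq> carrier M" using M(2) by (auto simp: free_morphism_iff)
  then have "finite (g ` lists B)" using monoid_varietyD(3)[OF \<V> M(1)] finite_subset by blast
  then have "finite (carrier S)" by (simp add: kg)
  then obtain S' :: "nat monoid" and f where f: "f \<in> iso S S'" "monoid S'"
    using finite_monoid_copy[OF S(1)] by blast
  have f_morph: "monoid_morphism (free_monoid B) S' (f \<circ> \<mu>)"
    using free_morphism_iso S(2) f S(1) by blast
  have "submonoid (g ` lists B) M"
  proof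
    show "g ` lists B \<subseteq> carrier M" by fact
    show "x \<otimes>\<^bsub>M\<^esub> y \<in> g ` lists B" if xy: "x \<in> g ` lists B" "y \<in> g ` lists B" for x y
    proof -
      obtain u v where "x = g u" "y = g v" "u \<in> lists B" "v \<in> lists B" using xy by auto
      then have "x \<otimes>\<^bsub>M\<^esub> y = g (u @ v)" "u @ v \<in> lists B" using M(2) by (auto simp: free_morphism_iff)
      then show ?thesis by blast
    qed
    show "\<one>\<^bsub>M\<^esub> \<in> g ` lists B" using M(2) by (auto simp: free_morphism_iff intro!: image_eqI[of _ _ "[]"])
  qed
  moreover have "monoid_morphism (M\<lparr>carrier := g ` lists B\<rparr>) S' (f \<circ> k)"
  proof -
    have gm: "g u \<otimes>\<^bsub>M\<^esub> g v = g (u @ v)" if "u \<in> lists B" "v \<in> lists B" for u v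
      using M(2) that by (simp add: free_morphism_iff)
    have g1: "\<one>\<^bsub>M\<^esub> = g []" using M(2) by (simp add: free_morphism_iff)
    show ?thesis
      using f_morph by (auto simp: monoid_morphism_def hom_def gm free_morphism_iff g1 k Pi_iff)
  qed
  moreover have "(f \<circ> k) ` g ` lists B = carrier S'"
    using f(1) unfolding image_comp[symmetric] kg[symmetric] by (simp add: iso_def bij_betw_def)
  ultimately have "monoid_divides S' M" unfolding monoid_divides_def by blast
  then have "S' \<in> \<V>" using monoid_varietyD(4)[OF \<V> M(1) f(2)] by blast
  then show ?thesis using f(1) by (auto simp: belongs_def is_iso_def)
qed

text \<open>The last assumption makes \<open>L\<close> a union of fibres of \<open>\<mu>\<close>, so
  the image of \<open>L\<close> serves as accepting set; the isomorphism onto a member keeps fibres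
  apart.\<close>

lemma recognized_by_member:
  assumes "belongs S \<V>" "monoid S" "monoid_variety \<V>"
    and \<mu>: "monoid_morphism (free_monoid B) S \<mu>" and "L \<subseteq> lists B"
    and "\<And>u v. u \<in> L \<Longrightarrow> v \<in> lists B \<Longrightarrow> \<mu> u = \<mu> v \<Longrightarrow> v \<in> L"
  shows "\<exists>M\<in>\<V>. recognizes M B L"
proof -
  obtain M f where M: "M \<in> \<V>" "f \<in> iso S M" using assms(1) by (auto simp: belongs_def is_iso_def)
  have "monoid_morphism (free_monoid B) M (f \<circ> \<mu>)"
    using free_morphism_iso[OF \<mu> M(2)] assms(2) monoid_varietyD(2)[OF assms(3) M(1)] by blast
  moreover have "inj_on f (carrier S)" using M(2) by (auto simp: iso_def bij_betw_def)
  then have "L = {w \<in> lists B. (f \<circ> \<mu>) w \<in> (f \<circ> \<mu>) ` L}"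
    using assms(5,6) \<mu> by (fastforce simp: free_morphism_iff inj_on_def)
  moreover have "(f \<circ> \<mu>) ` L \<subseteq> carrier M"
    using \<open>monoid_morphism (free_monoid B) M (f \<circ> \<mu>)\<close> assms(5) by (auto simp: free_morphism_iff)
  ultimately show ?thesis using M(1) unfolding recognizes_def by blast
qed

section \<open>Stability\<close>

lemma words_append: "words A (m + n) = {u @ v |u v. u \<in> words A m \<and> v \<in> words A n}"
proof (intro equalityI subsetI)
  fix w assume w: "w \<in> words A (m + n)"
  then have "w = take m w @ drop m w" "take m w \<in> words A m" "drop m w \<in> words A n"
    by (auto simp: words_def dest: in_set_takeD in_set_dropD)
  then show "w \<in> {u @ v |u v. u \<in> words A m \<and> v \<in> words A n}" by blast
qed (auto simp: words_def)

lemma words_multiple: "{w \<in> lists A. t dvd length w} = (\<Union>n. words A (n * t))"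
  by (auto simp: words_def dvd_def mult.commute)

lemma concat_words_length: "ws \<in> lists (words A t) \<Longrightarrow> length (concat ws) = length ws * t"
  by (induction ws) (auto simp: words_def)

lemma concat_words:
  assumes "t > 0"
  shows "concat ` lists (words A t) = {w \<in> lists A. t dvd length w}"
proof (intro equalityI subsetI)
  fix w assume "w \<in> {w \<in> lists A. t dvd length w}"
  then obtain n where "w \<in> words A (n * t)"
    unfolding words_multiple by blast
  then show "w \<in> concat ` lists (words A t)"
  proof (induction n arbitrary: w)
    case 0
    then show ?case by (auto simp: words_def intro!: image_eqI[of _ _ "[]"])
  next
    case (Suc n)
    then obtain u v where "w = u @ v" "u \<in> words A t" "v \<in> words A (n * t)"
      by (auto simp: words_append)
    moreover obtain vs where "vs \<in> lists (words A t)" "v = concat vs"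
      using Suc.IH \<open>v \<in> words A (n * t)\<close> by blast
    ultimately show ?case by (intro image_eqI[of _ _ "u # vs"]) auto
  qed
next
  fix w assume "w \<in> concat ` lists (words A t)"
  then obtain ws where ws: "w = concat ws" "ws \<in> lists (words A t)" by blast
  then have "w \<in> lists A" by (auto simp: words_def lists_eq_set)
  then show "w \<in> {w \<in> lists A. t dvd length w}" using ws concat_words_length[OF ws(2)] by simp
qed

locale word_morphism = M: monoid M for M :: "'m monoid" (structure) +
  fixes A :: "'a set" and h :: "'a list \<Rightarrow> 'm"
  assumes morphism: "monoid_morphism (free_monoid A) M h"
begin

lemma closed [simp]: "u \<in> lists A \<Longrightarrow> h u \<in> carrier M"
  and append: "u \<in> lists A \<Longrightarrow> v \<in> lists A \<Longrightarrow> h (u @ v) = h u \<otimes> h v"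
  and empty: "h [] = \<one>"
  using morphism unfolding free_morphism_iff by blast+

text \<open>The condition of the stability index without minimality: all such \<open>t\<close> lead
  to the same stable monoid, so a computation may use a convenient large one.\<close>

definition stable :: "nat \<Rightarrow> bool" where
  "stable t \<longleftrightarrow> t > 0 \<and> h ` words A t = h ` words A (2 * t)"

text \<open>The images of the words of length \<open>n\<close> form the \<open>n\<close>-th power of
  the set of images of letters, in the monoid of subsets; stability is idempotence of such a
  power.\<close>

lemma image_words_add:
  "h ` words A (m + n) = (\<lambda>(x, y). x \<otimes> y) ` (h ` words A m \<times> h ` words A n)"
proof -
  have "h (u @ v) = h u \<otimes> h v" if "u \<in> words A m" "v \<in> words A n" for u v
    using that append by (auto simp: words_def)
  then show ?thesis unfolding words_append by (auto simp: image_iff) metis+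
qed

lemma stable_mult:
  assumes "stable t" "n > 0"
  shows "h ` words A (n * t) = h ` words A t"
  using assms(2)
proof (induction n rule: nat_induct_non_zero)
  case (Suc n)
  have "h ` words A (Suc n * t) = h ` words A (t + t)"
    using Suc by (simp add: image_words_add)
  then show ?case using assms(1) by (simp add: stable_def mult_2)
qed simp

text \<open>Both sides equal the image of the words of length \<open>s * t\<close>.\<close>

lemma stable_unique: "stable s \<Longrightarrow> stable t \<Longrightarrow> h ` words A s = h ` words A t"
  by (metis mult.commute stable_def stable_mult)

lemma stable_multiple: "stable t \<Longrightarrow> n > 0 \<Longrightarrow> stable (n * t)"
  using stable_mult[of t n] stable_mult[of t "2 * n"] by (simp add: stable_def mult.assoc)

text \<open>All positive multiples of \<open>t\<close> give the same image as \<open>t\<close>; the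
  unit accounts for the empty word.\<close>

lemma stable_image:
  assumes "stable t"
  shows "h ` {w \<in> lists A. t dvd length w} = insert \<one> (h ` words A t)"
proof (intro equalityI subsetI)
  fix x assume "x \<in> h ` {w \<in> lists A. t dvd length w}"
  then obtain w n where w: "x = h w" "w \<in> words A (n * t)"
    unfolding words_multiple by blast
  show "x \<in> insert \<one> (h ` words A t)"
  proof (cases "n = 0")
    case True
    then show ?thesis using w empty by (auto simp: words_def)
  next
    case False
    then show ?thesis using stable_mult[OF assms, of n] w by auto
  qed
next
  fix x assume "x \<in> insert \<one> (h ` words A t)"
  then show "x \<in> h ` {w \<in> lists A. t dvd length w}"
    using empty by (auto simp: words_def intro!: image_eqI[of \<one> _ "[]"])
qed

lemma stability_index_stable:
  assumes "stable t"
  shows "stable (stability_index A h)"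
  using assms LeastI[of "\<lambda>s. s > 0 \<and> h ` words A s = h ` words A (2 * s)" t]
  unfolding stable_def stability_index_def by blast

text \<open>The definition uses the stability index. By \<open>stable_image\<close> and
  \<open>stable_unique\<close> the carrier is the unit together with a set that is the same for all
  stable exponents.\<close>

lemma stable_monoid_eq:
  assumes "stable t"
  shows "stable_monoid A M h = M\<lparr>carrier := h ` {w \<in> lists A. t dvd length w}\<rparr>"
proof -
  have s: "stable (stability_index A h)" using assms by (rule stability_index_stable)
  have "{concat ws |ws. ws \<in> lists (words A (stability_index A h))} =
      {w \<in> lists A. stability_index A h dvd length w}"
    using concat_words[of "stability_index A h" A] s by (auto simp: stable_def)
  then show ?thesis
    using stable_image[OF s] stable_image[OF assms] stable_unique[OF s assms]
    unfolding stable_monoid_def by simp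
qed

lemma monoid_stable:
  assumes "stable t"
  shows "monoid (stable_monoid A M h)"
  unfolding stable_monoid_eq[OF assms]
proof (rule monoidI, goal_cases)
  case (1 x y)
  then obtain u v where "u \<in> lists A" "t dvd length u" "v \<in> lists A" "t dvd length v" "x = h u" "y = h v"
    by auto
  then have "x \<otimes> y = h (u @ v)" "u @ v \<in> {w \<in> lists A. t dvd length w}" using append by auto
  then show ?case by (simp) 
next
  case 2
  then show ?case using empty by (auto intro!: image_eqI[of _ _ "[]"])
qed (auto simp: M.m_assoc in_lists_conv_set)

text \<open>Two equal powers \<open>X\<^sup>i = X\<^sup>j\<close> among the first \<open>2 ^ N + 1\<close> powers of the set \<open>X\<close> of
  images of letters give the period \<open>j - i\<close>, which divides \<open>fact (2 ^ N)\<close>.\<close>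

lemma stable_fact:
  assumes "finite (h ` lists A)" "card (h ` lists A) \<le> N"
  shows "stable (fact (2 ^ N))"
proof -
  let ?X = "\<lambda>n. h ` words A n"
  have "?X ` {..2 ^ N} \<subseteq> Pow (h ` lists A)" by (auto simp: words_def)
  then have "card (?X ` {..2 ^ N}) \<le> card (Pow (h ` lists A))"
    using assms(1) by (intro card_mono) auto
  also have "\<dots> = 2 ^ card (h ` lists A)" using assms(1) by (simp add: card_Pow)
  also have "\<dots> \<le> (2::nat) ^ N" using assms(2) by simp
  finally have "\<not> inj_on ?X {..2 ^ N}" by (auto dest: card_image)
  then obtain i j where ij: "i < j" "j \<le> 2 ^ N" "?X i = ?X j"
    unfolding inj_on_def by (metis atMost_iff linorder_neqE_nat)
  have period: "?X (m + n * (j - i)) = ?X m" if "m \<ge> i" for m n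
  proof (induction n)
    case (Suc n)
    \<comment> \<open>Isolating a summand \<open>j\<close> allows it to be exchanged for
      \<open>i\<close>.\<close>
    have "m + Suc n * (j - i) = j + (m - i + n * (j - i))"
      using that ij(1) by simp
    then have "?X (m + Suc n * (j - i)) = ?X (i + (m - i + n * (j - i)))"
      using ij(3) by (simp only: image_words_add)
    also have "\<dots> = ?X (m + n * (j - i))" using that by simp
    finally show ?case using Suc by simp
  qed simp
  have "j - i dvd fact (2 ^ N)" using ij by (intro dvd_fact) auto
  then obtain n where n: "fact (2 ^ N) = n * (j - i)" by (metis dvd_def mult.commute)
  \<comment> \<open>The factorial is a multiple of the period and lies beyond the preperiod
    \<open>i\<close>, so its double gives the same power.\<close>
  have "i \<le> fact (2 ^ N)" using ij fact_ge_self[of "2 ^ N"] by linarith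
  then have "?X (fact (2 ^ N) + n * (j - i)) = ?X (fact (2 ^ N))" by (rule period)
  then show ?thesis unfolding stable_def n[symmetric] by (simp add: mult_2)
qed

text \<open>Pumping: in a word with at least \<open>N\<close> letters, two of the first
  \<open>N + 1\<close> prefixes have equal image, and the factor between them can be cut
  out.\<close>

lemma short_representative:
  assumes "finite (h ` lists A)" "card (h ` lists A) \<le> N" "u \<in> lists A"
  obtains v where "v \<in> lists A" "length v < N" "h v = h u"
proof -
  have "\<exists>v\<in>lists A. length v < N \<and> h v = h u"
    using assms(3)
  proof (induction "length u" arbitrary: u rule: less_induct)
    case less
    show ?case
    proof (cases "length u < N")
      case True
      then show ?thesis using less by blast
    next
      case False
      let ?p = "\<lambda>i. h (take i u)"
      have tk: "take i u \<in> lists A" "drop i u \<in> lists A" for i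
        using less(2) by (auto dest: in_set_takeD in_set_dropD)
      have "card (?p ` {..N}) \<le> card (h ` lists A)"
        using assms(1) tk by (intro card_mono) auto
      then have "\<not> inj_on ?p {..N}" using assms(2) by (auto dest: card_image)
      then obtain i j where ij: "i < j" "j \<le> N" "?p i = ?p j"
        unfolding inj_on_def by (metis atMost_iff linorder_neqE_nat)
      have "h (take i u @ drop j u) = h (take j u @ drop j u)"
        using append[OF tk(1) tk(2)] ij(3) by metis
      moreover have "length (take i u @ drop j u) < length u" using ij False by auto
      moreover have "take i u @ drop j u \<in> lists A" using tk by auto
      ultimately show ?thesis using less(1) by (metis append_take_drop_id)
    qed
  qed
  then show ?thesis using that by blast
qed

end

section \<open>The syntactic monoid\<close>

lemma equiv_syntactic_cong: "equiv (lists A) (syntactic_cong A L)"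
  by (rule equivI) (auto simp: syntactic_cong_def refl_on_def sym_def trans_def)

lemma syntactic_morphism_eq_iff:
  assumes "u \<in> lists A" "v \<in> lists A"
  shows "syntactic_morphism A L u = syntactic_morphism A L v \<longleftrightarrow>
    (\<forall>p\<in>lists A. \<forall>q\<in>lists A. p @ u @ q \<in> L \<longleftrightarrow> p @ v @ q \<in> L)"
  unfolding syntactic_morphism_def eq_equiv_class_iff[OF equiv_syntactic_cong assms]
  using assms by (auto simp: syntactic_cong_def)

lemma syntactic_morphism_append_cong:
  assumes "u \<in> lists A" "v \<in> lists A" "u' \<in> lists A" "v' \<in> lists A"
    and "syntactic_morphism A L u = syntactic_morphism A L u'"
    and "syntactic_morphism A L v = syntactic_morphism A L v'"
  shows "syntactic_morphism A L (u @ v) = syntactic_morphism A L (u' @ v')"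
proof -
  have u: "p @ u @ q \<in> L \<longleftrightarrow> p @ u' @ q \<in> L" if "p \<in> lists A" "q \<in> lists A" for p q
    using syntactic_morphism_eq_iff[OF assms(1,3)] assms(5) that by blast
  have v: "p @ v @ q \<in> L \<longleftrightarrow> p @ v' @ q \<in> L" if "p \<in> lists A" "q \<in> lists A" for p q
    using syntactic_morphism_eq_iff[OF assms(2,4)] assms(6) that by blast
  have "p @ (u @ v) @ q \<in> L \<longleftrightarrow> p @ (u' @ v') @ q \<in> L" if "p \<in> lists A" "q \<in> lists A" for p q
    using u[of p "v @ q"] v[of "p @ u'" q] assms(2,3) that by simp
  moreover have "u @ v \<in> lists A" "u' @ v' \<in> lists A" using assms(1-4) by simp_all
  ultimately show ?thesis by (simp only: syntactic_morphism_eq_iff) blast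
qed

text \<open>The product unites the classes of all concatenations of representatives; by the
  congruence property these are one and the same class.\<close>

lemma syntactic_mult:
  assumes "u \<in> lists A" "v \<in> lists A"
  shows "syntactic_morphism A L u \<otimes>\<^bsub>syntactic_monoid A L\<^esub> syntactic_morphism A L v =
    syntactic_morphism A L (u @ v)"
proof -
  have cl: "x \<in> lists A \<and> syntactic_morphism A L x = syntactic_morphism A L w"
    if "x \<in> syntactic_morphism A L w" for x w
    using that equiv_class_eq[OF equiv_syntactic_cong, of w x A L]
    by (auto simp: syntactic_morphism_def syntactic_cong_def)
  have "syntactic_morphism A L (x @ y) = syntactic_morphism A L (u @ v)"
    if "x \<in> syntactic_morphism A L u" "y \<in> syntactic_morphism A L v" for x y
    by (rule syntactic_morphism_append_cong) (use cl[OF that(1)] cl[OF that(2)] assms in simp_all)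
  moreover have "u \<in> syntactic_morphism A L u" "v \<in> syntactic_morphism A L v"
    unfolding syntactic_morphism_def by (intro equiv_class_self[OF equiv_syntactic_cong] assms)+
  ultimately show ?thesis unfolding syntactic_monoid_def monoid.simps by blast
qed

lemma syntactic_carrier: "carrier (syntactic_monoid A L) = syntactic_morphism A L ` lists A"
  by (auto simp: syntactic_monoid_def quotient_def syntactic_morphism_def)

lemma syntactic_one: "\<one>\<^bsub>syntactic_monoid A L\<^esub> = syntactic_morphism A L []"
  by (simp add: syntactic_monoid_def)

lemma monoid_syntactic: "monoid (syntactic_monoid A L)"
proof (rule monoidI, goal_cases)
  case (1 x y)
  then show ?case
    by (auto simp: syntactic_carrier syntactic_mult in_lists_conv_set intro!: imageI)
next
  case (3 x y z)
  then obtain u v w where "x = syntactic_morphism A L u" "y = syntactic_morphism A L v"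
      "z = syntactic_morphism A L w" "u \<in> lists A" "v \<in> lists A" "w \<in> lists A"
    by (auto simp: syntactic_carrier)
  then show ?case using syntactic_mult append_in_lists_conv append_assoc by metis
qed (auto simp: syntactic_carrier syntactic_one syntactic_mult in_lists_conv_set)

lemma syntactic_word_morphism:
  "word_morphism (syntactic_monoid A L) A (syntactic_morphism A L)"
proof -
  have "monoid_morphism (free_monoid A) (syntactic_monoid A L) (syntactic_morphism A L)"
    by (auto simp: free_morphism_iff syntactic_carrier syntactic_one syntactic_mult in_lists_conv_set)
  then show ?thesis
    by (simp add: word_morphism_def word_morphism_axioms_def monoid_syntactic)
qed

section \<open>Finiteness of the syntactic monoid\<close>

lemma dfa_step_closed:
  assumes "wf_dfa D" "q < length (table D)" "a \<in> set (letters D)"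
  shows "dfa_step D q a < length (table D)"
proof -
  let ?row = "table D ! q"
  have row: "length ?row = length (letters D)" "\<forall>q\<in>set ?row. q < length (table D)"
    using assms(1,2) by (auto simp: wf_dfa_def)
  obtain i where i: "i < length (letters D)" "letters D ! i = a"
    using assms(3) by (auto simp: in_set_conv_nth)
  then have "map_of (zip (letters D) ?row) a = Some (?row ! i)"
    using assms(1) row map_of_zip_nth[of "letters D" ?row i] by (auto simp: wf_dfa_def)
  then show ?thesis using row i by (simp add: dfa_step_def)
qed

lemma dfa_run_closed:
  assumes "wf_dfa D" "q < length (table D)" "u \<in> lists (set (letters D))"
  shows "foldl (dfa_step D) q u < length (table D)"
  using assms(2,3) by (induction u arbitrary: q) (auto simp: dfa_step_closed[OF assms(1)] in_lists_conv_set)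

text \<open>A word acts on the \<open>n\<close> states of the automaton, and words with equal action
  have equal class. There are at most \<open>n ^ n\<close> actions.\<close>

lemma syntactic_card_le:
  fixes D
  defines "n \<equiv> length (table D)" and "A \<equiv> set (letters D)"
  assumes "wf_dfa D"
  shows "finite (syntactic_morphism A (dfa_lang D) ` lists A)"
    "card (syntactic_morphism A (dfa_lang D) ` lists A) \<le> n ^ n"
proof -
  let ?run = "foldl (dfa_step D)"
  \<comment> \<open>Restriction to the states places the actions in a finite function space.\<close>
  let ?\<mu> = "\<lambda>u. restrict (\<lambda>q. ?run q u) {..<n}"
  have closed: "?run q u < n" if "q < n" "u \<in> lists A" for q u
    using dfa_run_closed[OF assms(3)] that by (simp add: n_def A_def)
  have start: "start D < n" using assms(3) by (simp add: wf_dfa_def n_def)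
  have cong: "syntactic_morphism A (dfa_lang D) u = syntactic_morphism A (dfa_lang D) v"
    if "u \<in> lists A" "v \<in> lists A" "?\<mu> u = ?\<mu> v" for u v
    unfolding syntactic_morphism_eq_iff[OF that(1,2)]
  proof (intro ballI)
    fix p q assume pq: "p \<in> lists A" "q \<in> lists A"
    have "?run (?run (start D) p) u = ?run (?run (start D) p) v"
      using fun_cong[OF that(3), of "?run (start D) p"] closed[OF start pq(1)] by simp
    then show "p @ u @ q \<in> dfa_lang D \<longleftrightarrow> p @ v @ q \<in> dfa_lang D"
      using that(1,2) pq by (simp add: dfa_lang_def A_def[symmetric])
  qed
  obtain k where "\<And>u. u \<in> lists A \<Longrightarrow> syntactic_morphism A (dfa_lang D) u = k (?\<mu> u)"
    using function_factors_left_gen[of "\<lambda>u. u \<in> lists A" ?\<mu> "syntactic_morphism A (dfa_lang D)"] cong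
    by blast
  then have eq: "syntactic_morphism A (dfa_lang D) ` lists A = k ` ?\<mu> ` lists A"
    by (simp add: image_image)
  have sub: "?\<mu> ` lists A \<subseteq> {..<n} \<rightarrow>\<^sub>E {..<n}"
    using closed by (intro image_subsetI) (simp add: PiE_iff extensional_def)
  have fin: "finite ({..<n} \<rightarrow>\<^sub>E {..<n})" by (simp add: finite_PiE)
  then have "finite (?\<mu> ` lists A)" using sub finite_subset by blast
  then show "finite (syntactic_morphism A (dfa_lang D) ` lists A)"
    "card (syntactic_morphism A (dfa_lang D) ` lists A) \<le> n ^ n"
    using card_image_le[of "?\<mu> ` lists A" k] card_mono[OF fin sub] unfolding eq
    by (simp_all add: card_PiE)
qed

section \<open>Definability with modular predicates\<close>

lemma lang_stable_monoid_eq: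
  assumes "word_morphism.stable A (syntactic_morphism A L) t"
  shows "lang_stable_monoid A L =
    (syntactic_monoid A L)\<lparr>carrier := syntactic_morphism A L ` {w \<in> lists A. t dvd length w}\<rparr>"
    "monoid (lang_stable_monoid A L)"
  using word_morphism.stable_monoid_eq[OF syntactic_word_morphism assms]
    word_morphism.monoid_stable[OF syntactic_word_morphism assms]
  unfolding lang_stable_monoid_def by simp_all

lemma equivalentD:
  assumes "equivalent F \<V>" "finite A" "L \<subseteq> lists A"
  shows "definable F A L \<longleftrightarrow> (\<exists>M\<in>\<V>. recognizes M A L)"
  using assms unfolding equivalent_def by blast

text \<open>Serves to choose the monoid, the morphism and the accepting set of each recognized
  language at once.\<close>

lemma bchoice3:
  assumes "\<forall>x\<in>X. \<exists>a b c. Q x a b c"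
  shows "\<exists>f g h. \<forall>x\<in>X. Q x (f x) (g x) (h x)"
proof -
  have "\<forall>x\<in>X. \<exists>t. Q x (fst t) (fst (snd t)) (snd (snd t))" using assms by force
  from bchoice[OF this] obtain t where
    "\<forall>x\<in>X. Q x (fst (t x)) (fst (snd (t x))) (snd (snd (t x)))" by blast
  then show ?thesis
    by (intro exI[of _ "\<lambda>x. fst (t x)"] exI[of _ "\<lambda>x. fst (snd (t x))"] exI[of _ "\<lambda>x. snd (snd (t x))"])
qed

text \<open>Each letter of \<open>B\<close> stands for a block of \<open>t\<close> letters, decoded
  by \<open>e\<close>; both the blocks themselves and their numbers will serve as letters.
  Concatenations of blocks are the words of length divisible by \<open>t\<close>, hence
  surjectivity.\<close>

lemma stable_letters_morphism:
  assumes "word_morphism.stable A (syntactic_morphism A L) t" "e ` B = words A t"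
  shows "monoid_morphism (free_monoid B) (lang_stable_monoid A L)
      (\<lambda>w. syntactic_morphism A L (concat (map e w)))"
    "carrier (lang_stable_monoid A L) = (\<lambda>w. syntactic_morphism A L (concat (map e w))) ` lists B"
    "w \<in> lists B \<Longrightarrow> concat (map e w) \<in> lists A"
    "w \<in> lists B \<Longrightarrow> length (concat (map e w)) = length w * t"
proof -
  have t: "t > 0" using assms(1) by (simp add: word_morphism.stable_def[OF syntactic_word_morphism])
  have *: "map e w \<in> lists (words A t)" if "w \<in> lists B" for w
    using that unfolding assms(2)[symmetric] lists_image by blast
  have len: "concat (map e w) \<in> {w \<in> lists A. t dvd length w}" if "w \<in> lists B" for w
    using *[OF that] unfolding concat_words[OF t, symmetric] by blast
  then show w: "concat (map e w) \<in> lists A" if "w \<in> lists B" for w using that by blast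
  show "length (concat (map e w)) = length w * t" if "w \<in> lists B" for w
    using concat_words_length[OF *[OF that]] by simp
  show carr: "carrier (lang_stable_monoid A L) = (\<lambda>w. syntactic_morphism A L (concat (map e w))) ` lists B"
    unfolding lang_stable_monoid_eq(1)[OF assms(1)] concat_words[OF t, symmetric]
      assms(2)[symmetric] lists_image by (simp add: image_image)
  show "monoid_morphism (free_monoid B) (lang_stable_monoid A L)
      (\<lambda>w. syntactic_morphism A L (concat (map e w)))"
    unfolding free_morphism_iff
  proof (intro conjI ballI)
    show "syntactic_morphism A L (concat (map e u)) \<in> carrier (lang_stable_monoid A L)"
      if "u \<in> lists B" for u using that carr by blast
    show "syntactic_morphism A L (concat (map e (u @ v))) =
        syntactic_morphism A L (concat (map e u)) \<otimes>\<^bsub>lang_stable_monoid A L\<^esub>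
        syntactic_morphism A L (concat (map e v))" if "u \<in> lists B" "v \<in> lists B" for u v
      using syntactic_mult[OF w[OF that(1)] w[OF that(2)], of L]
      by (simp add: lang_stable_monoid_eq(1)[OF assms(1)])
  qed (simp add: lang_stable_monoid_eq(1)[OF assms(1)] syntactic_one)
qed

text \<open>A word inside a context is annotated with an offset, namely the length of the left
  context modulo \<open>d\<close>, so the stable monoid is separated by the \<open>d\<^sup>2\<close> morphisms obtained
  from the \<open>d\<close> residues of the total length and the \<open>d\<close> offsets.\<close>

lemma definable_MOD_imp_stable:
  assumes F: "fragment \<sigma> F" and \<V>: "monoid_variety \<V>" and eqv: "equivalent F \<V>"
    and A: "finite A" and fin: "finite (syntactic_morphism A L ` lists A)"
    and L: "definable (enrich \<sigma> F MOD) A L"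
  shows "belongs (lang_stable_monoid A L) \<V>"
proof -
  interpret word_morphism "syntactic_monoid A L" A "syntactic_morphism A L"
    by (rule syntactic_word_morphism)
  obtain \<phi> where \<phi>: "\<phi> \<in> enrich \<sigma> F MOD" "L = formula_lang A \<phi>"
    using L by (auto simp: definable_def)
  have wf: "MSO (\<sigma> \<union> MOD) \<phi>" "fv1 \<phi> = {}"
    using enrich_wf[OF \<phi>(1) F] by (auto simp: closed_formula_def)
  obtain d\<^sub>0 where d\<^sub>0: "d\<^sub>0 > 0" "MSO (\<sigma> \<union> periodic d\<^sub>0) \<phi>"
    using MSO_MOD_periodic[OF wf(1)] by blast
  obtain s where s: "stable s" using stable_fact[OF fin order_refl] by blast
  \<comment> \<open>The modulus has to be stable and also a period of the modular predicates of
    \<phi>; both properties pass to multiples.\<close>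
  define d where "d = d\<^sub>0 * s"
  have d: "stable d" "d > 0" using stable_multiple[OF s d\<^sub>0(1)] by (auto simp: d_def stable_def)
  have \<phi>d: "MSO (\<sigma> \<union> periodic d) \<phi>"
    using MSO_mono[OF d\<^sub>0(2)] periodic_mult[of d\<^sub>0 s] by (auto simp: d_def)
  obtain as where as: "set as = A" using A finite_list by blast
  define \<psi> where "\<psi> r = map_atoms (to_annotation \<sigma> as d r) \<phi>" for r
  let ?A = "annotated_alphabet d A"
  have "\<psi> r \<in> F" for r
    unfolding \<psi>_def by (rule enrich_to_annotation[OF \<phi>(1) F]) (auto simp: MOD_def MOD_at_def)
  then have "definable F ?A (formula_lang ?A (\<psi> r))" for r
    by (auto simp: definable_def)
  then have "\<exists>M\<in>\<V>. recognizes M ?A (formula_lang ?A (\<psi> r))" for r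
    using equivalentD[OF eqv finite_annotated_alphabet[OF A]] by (simp add: formula_lang_def)
  then have "\<forall>r\<in>UNIV. \<exists>M h P. M \<in> \<V> \<and> monoid_morphism (free_monoid ?A) M h \<and>
      formula_lang ?A (\<psi> r) = {w \<in> lists ?A. h w \<in> P}"
    unfolding recognizes_def by blast
  from bchoice3[OF this] obtain M h P where
    "\<forall>r\<in>UNIV. M r \<in> \<V> \<and> monoid_morphism (free_monoid ?A) (M r) (h r) \<and>
      formula_lang ?A (\<psi> r) = {w \<in> lists ?A. h r w \<in> P r}" by blast
  then have M: "\<And>r. M r \<in> \<V>" "\<And>r. monoid_morphism (free_monoid ?A) (M r) (h r)"
    and P: "\<And>r. formula_lang ?A (\<psi> r) = {w \<in> lists ?A. h r w \<in> P r}" by blast+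
  have ann: "annotate d i w \<in> lists ?A" if "w \<in> lists A" for i w
    using annotate_in_lists[OF d(2) that] .
  \<comment> \<open>Each word is tested by the translation made for the residue of its own
    length.\<close>
  have mem: "w \<in> L \<longleftrightarrow> h (length w mod d) (annotate d 0 w) \<in> P (length w mod d)"
    if "w \<in> lists A" for w
  proof -
    have "w \<in> L \<longleftrightarrow> annotate d 0 w \<in> formula_lang ?A (\<psi> (length w mod d))"
      using that ann[OF that] sat_to_annotation[OF \<phi>d d(2), of w as] wf(2) as
      by (simp add: \<phi>(2) formula_lang_def \<psi>_def)
    then show ?thesis using P ann[OF that] by simp
  qed
  have happ: "h r (u @ v) = h r u \<otimes>\<^bsub>M r\<^esub> h r v" if "u \<in> lists ?A" "v \<in> lists ?A" for r u v
    using M(2)[of r] that unfolding free_morphism_iff by blast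
  let ?B = "words A d"
  have e: "id ` ?B = words A d" by simp
  note B = stable_letters_morphism[OF d(1) e, unfolded list.map_id id_apply]
  show ?thesis
  proof (rule belongs_variety_of_morphisms[OF \<V>, of "{..<d} \<times> {..<d}" "\<lambda>(r, i). M r" ?B
        "\<lambda>(r, i) w. h r (annotate d i (concat w))"])
    fix ri assume "ri \<in> {..<d} \<times> {..<d}"
    obtain r i where ri: "ri = (r, i)" by (cases ri)
    \<comment> \<open>The block word \<open>u\<close> has length divisible by \<open>d\<close>, so
      the offset is back at \<open>i\<close> when \<open>v\<close> begins.\<close>
    have "annotate d i (concat (u @ v)) = annotate d i (concat u) @ annotate d i (concat v)"
      if "u \<in> lists ?B" for u v
    proof -
      have "(i + length (concat u)) mod d = i mod d" using B(4)[OF that] by simp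
      then show ?thesis using annotate_mod[of d "i + length (concat u)"] annotate_mod[of d i]
        by (simp add: annotate_append)
    qed
    then have "monoid_morphism (free_monoid ?B) (M r) (\<lambda>w. h r (annotate d i (concat w)))"
      using M(2)[of r] happ ann B(3) by (simp add: free_morphism_iff)
    then show "(case ri of (r, i) \<Rightarrow> M r) \<in> \<V> \<and>
        monoid_morphism (free_monoid ?B) (case ri of (r, i) \<Rightarrow> M r)
          ((\<lambda>(r, i) w. h r (annotate d i (concat w))) ri)"
      using M(1) ri by simp
  next
    fix u v
    assume uv: "u \<in> lists ?B" "v \<in> lists ?B"
      and eq: "\<And>ri. ri \<in> {..<d} \<times> {..<d} \<Longrightarrow>
        (\<lambda>(r, i) w. h r (annotate d i (concat w))) ri u = (\<lambda>(r, i) w. h r (annotate d i (concat w))) ri v"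
    have eq': "h r (annotate d i (concat u)) = h r (annotate d i (concat v))" if "r < d" for r i
      using eq[of "(r, i mod d)"] that d(2) by (simp add: annotate_mod)
    note u = B(3,4)[OF uv(1)] and v = B(3,4)[OF uv(2)]
    show "syntactic_morphism A L (concat u) = syntactic_morphism A L (concat v)"
      unfolding syntactic_morphism_eq_iff[OF u(1) v(1)]
    proof (intro ballI)
      fix p q assume pq: "p \<in> lists A" "q \<in> lists A"
      define r where "r = (length p + length q) mod d"
      \<comment> \<open>The inserted block word affects neither the residue of the total length nor
        the offset at which \<open>q\<close> is annotated.\<close>
      have len: "length (p @ concat w @ q) mod d = r" if "w \<in> lists ?B" for w
      proof -
        have "length (p @ concat w @ q) = length p + length q + length w * d"
          using B(4)[OF that] by simp
        then show ?thesis unfolding r_def by (simp only: mod_mult_self1)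
      qed
      have shift: "annotate d (length p + length (concat w)) q = annotate d (length p) q"
        if "w \<in> lists ?B" for w
        using B(4)[OF that] annotate_mod[of d "length p + length (concat w)" q]
          annotate_mod[of d "length p" q] by simp
      have "h r (annotate d 0 (p @ concat w @ q)) = h r (annotate d 0 p) \<otimes>\<^bsub>M r\<^esub>
          (h r (annotate d (length p) (concat w)) \<otimes>\<^bsub>M r\<^esub> h r (annotate d (length p) q))"
        if "w \<in> lists ?B" for w
        using pq B(3)[OF that] ann by (simp add: annotate_append happ shift[OF that])
      moreover have "r < d" using d(2) by (simp add: r_def)
      ultimately have "h r (annotate d 0 (p @ concat u @ q)) = h r (annotate d 0 (p @ concat v @ q))"
        using uv eq' by simp
      then show "p @ concat u @ q \<in> L \<longleftrightarrow> p @ concat v @ q \<in> L"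
        using mem[of "p @ concat u @ q"] mem[of "p @ concat v @ q"] pq u(1) v(1)
          len[OF uv(1)] len[OF uv(2)] by simp
    qed
  next
    show "monoid (lang_stable_monoid A L)" using lang_stable_monoid_eq(2)[OF d(1)] .
  qed (use B in auto)
qed

section \<open>Testing the stable monoid by finitely many languages\<close>

lemma stable_imp_small_contexts_definable:
  assumes \<V>: "monoid_variety \<V>" and eqv: "equivalent F \<V>"
    and t: "word_morphism.stable A (syntactic_morphism A L) t" and e: "e ` B = words A t"
    and "finite B" and S: "belongs (lang_stable_monoid A L) \<V>" and uv: "u \<in> lists A" "v \<in> lists A"
  shows "definable F B {w \<in> lists B. u @ concat (map e w) @ v \<in> L}"
proof -
  note B = stable_letters_morphism[OF t e]
  let ?L = "{w \<in> lists B. u @ concat (map e w) @ v \<in> L}"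
  \<comment> \<open>Block words of the same class are interchangeable in the context, so the stable
    monoid recognizes the language.\<close>
  have "\<exists>M\<in>\<V>. recognizes M B ?L"
  proof (rule recognized_by_member[OF S lang_stable_monoid_eq(2)[OF t] \<V> B(1)])
    fix x y assume x: "x \<in> ?L" and y: "y \<in> lists B"
      and eq: "syntactic_morphism A L (concat (map e x)) = syntactic_morphism A L (concat (map e y))"
    have "x \<in> lists B" using x by simp
    then show "y \<in> ?L"
      using x y eq uv syntactic_morphism_eq_iff[OF B(3) B(3), of x y] by blast
  qed blast
  moreover have "?L \<subseteq> lists B" by blast
  ultimately show ?thesis using equivalentD[OF eqv \<open>finite B\<close>] by blast
qed

text \<open>For the converse, the morphisms recognizing these finitely many languages separate the
  stable monoid: agreement in contexts shorter than \<open>N\<close> gives agreement in all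
  contexts, since each side of a context has a short representative of the same class.\<close>

lemma stable_iff_small_contexts_definable:
  assumes \<V>: "monoid_variety \<V>" and eqv: "equivalent F \<V>"
    and "finite A" and fin: "finite (syntactic_morphism A L ` lists A)"
    and N: "card (syntactic_morphism A L ` lists A) \<le> N"
    and t: "word_morphism.stable A (syntactic_morphism A L) t" and e: "e ` B = words A t"
    and "finite B"
  shows "belongs (lang_stable_monoid A L) \<V> \<longleftrightarrow>
    (\<forall>u\<in>lists A. \<forall>v\<in>lists A. length u < N \<and> length v < N \<longrightarrow>
      definable F B {w \<in> lists B. u @ concat (map e w) @ v \<in> L})"
proof
  assume "belongs (lang_stable_monoid A L) \<V>"
  then show "\<forall>u\<in>lists A. \<forall>v\<in>lists A. length u < N \<and> length v < N \<longrightarrow>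
      definable F B {w \<in> lists B. u @ concat (map e w) @ v \<in> L}"
    using stable_imp_small_contexts_definable[OF \<V> eqv t e \<open>finite B\<close>] by blast
next
  interpret word_morphism "syntactic_monoid A L" A "syntactic_morphism A L"
    by (rule syntactic_word_morphism)
  note B = stable_letters_morphism[OF t e]
  assume def: "\<forall>u\<in>lists A. \<forall>v\<in>lists A. length u < N \<and> length v < N \<longrightarrow>
      definable F B {w \<in> lists B. u @ concat (map e w) @ v \<in> L}"
  define short where "short = {u \<in> lists A. length u < N}"
  let ?L = "\<lambda>(u, v). {w \<in> lists B. u @ concat (map e w) @ v \<in> L}"
  have "finite short"
    using finite_lists_length_le[OF \<open>finite A\<close>, of N] by (rule rev_finite_subset) (auto simp: short_def)
  have "\<forall>uv\<in>short \<times> short. \<exists>M h P. M \<in> \<V> \<and> monoid_morphism (free_monoid B) M h \<and>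
      ?L uv = {w \<in> lists B. h w \<in> P}"
  proof
    fix uv assume "uv \<in> short \<times> short"
    then have "definable F B (?L uv)" "?L uv \<subseteq> lists B" using def by (auto simp: short_def)
    then obtain M where "M \<in> \<V>" "recognizes M B (?L uv)"
      using equivalentD[OF eqv \<open>finite B\<close>] by meson
    then show "\<exists>M h P. M \<in> \<V> \<and> monoid_morphism (free_monoid B) M h \<and>
        ?L uv = {w \<in> lists B. h w \<in> P}"
      unfolding recognizes_def by blast
  qed
  from bchoice3[OF this] obtain M h P where M: "\<forall>uv\<in>short \<times> short. M uv \<in> \<V> \<and>
      monoid_morphism (free_monoid B) (M uv) (h uv) \<and> ?L uv = {w \<in> lists B. h uv w \<in> P uv}"
    by blast
  show "belongs (lang_stable_monoid A L) \<V>"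
  proof (rule belongs_variety_of_morphisms[OF \<V> _ _ lang_stable_monoid_eq(2)[OF t] B(1,2)])
    show "finite (short \<times> short)" using \<open>finite short\<close> by simp
    show "M uv \<in> \<V> \<and> monoid_morphism (free_monoid B) (M uv) (h uv)" if "uv \<in> short \<times> short" for uv
      using M that by blast
  next
    fix x y assume xy: "x \<in> lists B" "y \<in> lists B"
      and eq: "\<And>uv. uv \<in> short \<times> short \<Longrightarrow> h uv x = h uv y"
    show "syntactic_morphism A L (concat (map e x)) = syntactic_morphism A L (concat (map e y))"
      unfolding syntactic_morphism_eq_iff[OF B(3)[OF xy(1)] B(3)[OF xy(2)]]
    proof (intro ballI)
      fix p q assume pq: "p \<in> lists A" "q \<in> lists A"
      obtain p' where p': "p' \<in> lists A" "length p' < N" "syntactic_morphism A L p' = syntactic_morphism A L p"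
        using short_representative[OF fin N pq(1)] .
      obtain q' where q': "q' \<in> lists A" "length q' < N" "syntactic_morphism A L q' = syntactic_morphism A L q"
        using short_representative[OF fin N pq(2)] .
      have pq': "(p', q') \<in> short \<times> short" using p' q' by (auto simp: short_def)
      have "p @ w @ q \<in> L \<longleftrightarrow> p' @ w @ q' \<in> L" if w: "w \<in> lists A" for w
      proof -
        have "[] @ p @ (w @ q) \<in> L \<longleftrightarrow> [] @ p' @ (w @ q) \<in> L"
          using syntactic_morphism_eq_iff[OF p'(1) pq(1), of L] p'(3) w pq(2)
          by (metis append_in_lists_conv lists.Nil)
        moreover have "(p' @ w) @ q @ [] \<in> L \<longleftrightarrow> (p' @ w) @ q' @ [] \<in> L"
          using syntactic_morphism_eq_iff[OF q'(1) pq(2), of L] q'(3) w p'(1)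
          by (metis append_in_lists_conv lists.Nil)
        ultimately show ?thesis by simp
      qed
      moreover have "x \<in> ?L (p', q') \<longleftrightarrow> y \<in> ?L (p', q')"
        using M pq' eq[OF pq'] xy by (metis (mono_tags, lifting) mem_Collect_eq)
      ultimately show "p @ concat (map e x) @ q \<in> L \<longleftrightarrow> p @ concat (map e y) @ q \<in> L"
        using B(3) xy by simp
    qed
  qed
qed

section \<open>The category of words modulo s\<close>

context word_morphism
begin

text \<open>Locality is stated for categories of naturals, so the triple of source, class and target
  is coded by pairing, with \<open>e\<close> an injective numbering of the classes.\<close>

definition word_arrow :: "nat \<Rightarrow> ('m \<Rightarrow> nat) \<Rightarrow> nat \<Rightarrow> 'a list \<Rightarrow> nat" where
  "word_arrow s e i w = prod_encode (i, prod_encode (e (h w), (i + length w) mod s))"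

definition label :: "('m \<Rightarrow> nat) \<Rightarrow> nat \<Rightarrow> 'm" where
  "label e x = the_inv_into (h ` lists A) e (fst (prod_decode (snd (prod_decode x))))"

text \<open>Composition works on codes, by multiplying labels, so it does not depend on the words
  representing the arrows.\<close>

definition word_cat :: "nat \<Rightarrow> ('m \<Rightarrow> nat) \<Rightarrow> (nat, nat) cat" where
  "word_cat s e =
     \<lparr>Obj = {..<s}, Arr = {word_arrow s e i w |i w. i < s \<and> w \<in> lists A},
      Dom = (\<lambda>x. fst (prod_decode x)), Cod = (\<lambda>x. snd (prod_decode (snd (prod_decode x)))),
      Id = (\<lambda>i. word_arrow s e i []),
      Comp = (\<lambda>x y. prod_encode (fst (prod_decode x),
        prod_encode (e (label e x \<otimes> label e y), snd (prod_decode (snd (prod_decode y))))))\<rparr>"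

context
  fixes s :: nat and e :: "'m \<Rightarrow> nat"
  assumes s: "s > 0" and e: "inj_on e (h ` lists A)"
begin

lemma word_arrow_eq_iff:
  "u \<in> lists A \<Longrightarrow> v \<in> lists A \<Longrightarrow> word_arrow s e i u = word_arrow s e j v \<longleftrightarrow>
    i = j \<and> h u = h v \<and> (i + length u) mod s = (j + length v) mod s"
  using e by (auto simp: word_arrow_def inj_on_eq_iff)

lemma label_word_arrow: "w \<in> lists A \<Longrightarrow> label e (word_arrow s e i w) = h w"
  using e by (simp add: word_arrow_def label_def the_inv_into_f_f)

lemma word_cat_simps:
  "Obj (word_cat s e) = {..<s}"
  "Arr (word_cat s e) = {word_arrow s e i w |i w. i < s \<and> w \<in> lists A}"
  "Dom (word_cat s e) (word_arrow s e i w) = i"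
  "Cod (word_cat s e) (word_arrow s e i w) = (i + length w) mod s"
  "Id (word_cat s e) i = word_arrow s e i []"
  by (simp_all add: word_cat_def word_arrow_def)

text \<open>Reduces the category laws to the laws of concatenation.\<close>

lemma Comp_word_cat:
  assumes "u \<in> lists A" "v \<in> lists A" "j = (i + length u) mod s"
  shows "Comp (word_cat s e) (word_arrow s e i u) (word_arrow s e j v) = word_arrow s e i (u @ v)"
proof -
  have "(j + length v) mod s = (i + length (u @ v)) mod s"
    by (simp add: assms(3) mod_add_left_eq add.assoc)
  then show ?thesis
    using label_word_arrow[OF assms(1), of i] label_word_arrow[OF assms(2), of j]
    by (simp add: word_cat_def append[OF assms(1,2)]) (simp add: word_arrow_def append[OF assms(1,2)])
qed

lemma finite_category_word_cat:
  assumes "finite (h ` lists A)"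
  shows "finite_category (word_cat s e)"
proof -
  have "Arr (word_cat s e) \<subseteq> (\<lambda>(i, x, j). prod_encode (i, prod_encode (e x, j))) `
      ({..<s} \<times> h ` lists A \<times> {..<s})"
    using s by (auto simp: word_cat_simps word_arrow_def image_iff intro!: bexI)
  moreover have "finite ({..<s} \<times> h ` lists A \<times> {..<s})" using assms by simp
  ultimately have fin: "finite (Arr (word_cat s e))" using finite_subset finite_imageI by metis
  have arr: thesis if "x \<in> Arr (word_cat s e)"
      "\<And>i w. x = word_arrow s e i w \<Longrightarrow> i < s \<Longrightarrow> w \<in> lists A \<Longrightarrow> thesis" for x thesis
    using that by (auto simp: word_cat_simps)
  have mem: "word_arrow s e i w \<in> Arr (word_cat s e)" if "i < s" "w \<in> lists A" for i w
    using that by (auto simp: word_cat_simps)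
  show ?thesis
    unfolding finite_category_def
  proof (intro conjI ballI impI)
    show "finite (Arr (word_cat s e))" by fact
  next
    fix x assume "x \<in> Arr (word_cat s e)"
    then obtain i w where x: "x = word_arrow s e i w" "i < s" "w \<in> lists A" by (rule arr)
    show "Dom (word_cat s e) x \<in> Obj (word_cat s e)" "Cod (word_cat s e) x \<in> Obj (word_cat s e)"
      using x s by (simp_all add: word_cat_simps)
    show "Comp (word_cat s e) (Id (word_cat s e) (Dom (word_cat s e) x)) x = x"
      using Comp_word_cat[of "[]" w i i] x by (simp add: word_cat_simps)
    show "Comp (word_cat s e) x (Id (word_cat s e) (Cod (word_cat s e) x)) = x"
      using Comp_word_cat[of w "[]" "(i + length w) mod s" i] x by (simp add: word_cat_simps)
  next
    fix i assume "i \<in> Obj (word_cat s e)"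
    then show "Id (word_cat s e) i \<in> arrows (word_cat s e) i i"
      using mem[of i "[]"] by (simp add: arrows_def word_cat_simps(1,3,4,5))
  next
    fix x y assume xy: "x \<in> Arr (word_cat s e)" "y \<in> Arr (word_cat s e)"
      and eq: "Cod (word_cat s e) x = Dom (word_cat s e) y"
    obtain i u where x: "x = word_arrow s e i u" "i < s" "u \<in> lists A" using xy(1) by (rule arr)
    obtain j v where y: "y = word_arrow s e j v" "j < s" "v \<in> lists A" using xy(2) by (rule arr)
    have j: "j = (i + length u) mod s" using eq x y by (simp add: word_cat_simps)
    have "(i + length (u @ v)) mod s = (j + length v) mod s"
      by (simp add: j mod_add_left_eq add.assoc)
    then show "Comp (word_cat s e) x y
        \<in> arrows (word_cat s e) (Dom (word_cat s e) x) (Cod (word_cat s e) y)"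
      using mem[of i "u @ v"] x y Comp_word_cat[OF x(3) y(3) j]
      by (simp add: arrows_def word_cat_simps(3,4))
  next
    fix x y z
    assume xyz: "x \<in> Arr (word_cat s e)" "y \<in> Arr (word_cat s e)" "z \<in> Arr (word_cat s e)"
      and eq: "Cod (word_cat s e) x = Dom (word_cat s e) y \<and> Cod (word_cat s e) y = Dom (word_cat s e) z"
    obtain i u where x: "x = word_arrow s e i u" "i < s" "u \<in> lists A" using xyz(1) by (rule arr)
    obtain j v where y: "y = word_arrow s e j v" "j < s" "v \<in> lists A" using xyz(2) by (rule arr)
    obtain k w where z: "z = word_arrow s e k w" "k < s" "w \<in> lists A" using xyz(3) by (rule arr)
    have j: "j = (i + length u) mod s" and k: "k = (j + length v) mod s"
      using eq x y z by (simp_all add: word_cat_simps)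
    have k': "k = (i + length (u @ v)) mod s"
      by (simp add: j k mod_add_left_eq add.assoc)
    have "u @ v \<in> lists A" "v @ w \<in> lists A" using x y z by simp_all
    then show "Comp (word_cat s e) (Comp (word_cat s e) x y) z =
        Comp (word_cat s e) x (Comp (word_cat s e) y z)"
      using Comp_word_cat[OF x(3) y(3) j] Comp_word_cat[OF y(3) z(3) k]
        Comp_word_cat[OF _ z(3) k'] Comp_word_cat[OF x(3) _ j, of "v @ w"]
      by (simp add: x(1) y(1) z(1))
  qed (use s in \<open>simp_all add: word_cat_simps\<close>)
qed

lemma arrows_loop_word_cat:
  assumes "i < s"
  shows "arrows (word_cat s e) i i = word_arrow s e i ` {w \<in> lists A. s dvd length w}"
proof -
  have "(i + n) mod s = i \<longleftrightarrow> s dvd n" for n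
  proof
    assume "(i + n) mod s = i"
    then have "(i + n) mod s = (i + 0) mod s" using assms by simp
    then show "s dvd n" by (metis add_diff_cancel_left' mod_eq_dvd_iff_nat le_add1 add_0_right)
  qed (use assms in \<open>auto elim!: dvdE\<close>)
  then show ?thesis
    using assms by (auto simp: arrows_def word_cat_simps)
qed

text \<open>Loops at \<open>i\<close> share source and target, so each is determined by its
  label.\<close>

lemma local_monoid_word_cat:
  assumes "i < s"
  shows "label e \<in> iso (local_monoid (word_cat s e) i) (M\<lparr>carrier := h ` {w \<in> lists A. s dvd length w}\<rparr>)"
proof -
  let ?W = "{w \<in> lists A. s dvd length w}"
  have carr: "carrier (local_monoid (word_cat s e) i) = word_arrow s e i ` ?W"
    using arrows_loop_word_cat[OF assms] by (simp add: local_monoid_def)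
  have lab: "label e (word_arrow s e i w) = h w" if "w \<in> ?W" for w
    using label_word_arrow that by simp
  have "label e \<in> hom (local_monoid (word_cat s e) i) (M\<lparr>carrier := h ` ?W\<rparr>)"
  proof (rule homI)
    fix x assume "x \<in> carrier (local_monoid (word_cat s e) i)"
    then show "label e x \<in> carrier (M\<lparr>carrier := h ` ?W\<rparr>)" using lab unfolding carr by auto
  next
    fix x y assume xy: "x \<in> carrier (local_monoid (word_cat s e) i)"
      "y \<in> carrier (local_monoid (word_cat s e) i)"
    obtain u where u: "x = word_arrow s e i u" "u \<in> ?W" using xy(1) unfolding carr by blast
    obtain v where v: "y = word_arrow s e i v" "v \<in> ?W" using xy(2) unfolding carr by blast
    have uv: "u \<in> lists A" "v \<in> lists A" using u v by simp_all
    have i: "i = (i + length u) mod s" using u(2) assms by (auto elim!: dvdE)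
    have "x \<otimes>\<^bsub>local_monoid (word_cat s e) i\<^esub> y = word_arrow s e i (u @ v)"
      using Comp_word_cat[OF uv i] by (simp add: local_monoid_def u(1) v(1))
    then show "label e (x \<otimes>\<^bsub>local_monoid (word_cat s e) i\<^esub> y) =
        label e x \<otimes>\<^bsub>M\<lparr>carrier := h ` ?W\<rparr>\<^esub> label e y"
      using uv label_word_arrow by (simp add: u(1) v(1) append)
  qed
  moreover have "inj_on (label e) (word_arrow s e i ` ?W)"
  proof (rule inj_onI)
    fix x y assume xy: "x \<in> word_arrow s e i ` ?W" "y \<in> word_arrow s e i ` ?W" "label e x = label e y"
    obtain u where u: "x = word_arrow s e i u" "u \<in> ?W" using xy(1) by blast
    obtain v where v: "y = word_arrow s e i v" "v \<in> ?W" using xy(2) by blast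
    have "(i + length u) mod s = (i + length v) mod s" using u(2) v(2) by (auto elim!: dvdE)
    moreover have "h u = h v" using xy(3) lab[OF u(2)] lab[OF v(2)] by (simp add: u(1) v(1))
    ultimately show "x = y" using u v by (simp add: word_arrow_def)
  qed
  moreover have "label e ` word_arrow s e i ` ?W = h ` ?W"
    unfolding image_image by (rule image_cong) (use lab in auto)
  ultimately show ?thesis by (simp add: iso_def bij_betw_def carr)
qed

end

end

text \<open>Locality yields a division into a single monoid \<open>M\<close>. Coterminal arrows have
  disjoint sets of images, so one element of \<open>M\<close>, with source 0 and the residue of the
  length, pins down the class of a word and hence membership in \<open>L\<close>.\<close>

lemma stable_imp_definable_MOD:
  assumes F: "fragment \<sigma> F" and loc: "local_variety \<V>" and eqv: "equivalent F \<V>"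
    and A: "finite A" and L: "L \<subseteq> lists A" and fin: "finite (syntactic_morphism A L ` lists A)"
    and st: "word_morphism.stable A (syntactic_morphism A L) s"
    and S: "belongs (lang_stable_monoid A L) \<V>" and \<V>: "monoid_variety \<V>"
  shows "definable (enrich \<sigma> F (MOD_at s)) A L"
proof -
  interpret word_morphism "syntactic_monoid A L" A "syntactic_morphism A L"
    by (rule syntactic_word_morphism)
  let ?h = "syntactic_morphism A L"
  have s: "s > 0" using st by (simp add: stable_def)
  obtain e :: "nat list set \<Rightarrow> nat" where e: "inj_on e (?h ` lists A)"
    using finite_imp_inj_to_nat_seg[OF fin] by blast
  note cat = word_cat_simps[OF s e]
  let ?C = "word_cat s e"
  let ?a = "word_arrow s e"
  obtain N g where N: "N \<in> \<V>" "g \<in> iso (lang_stable_monoid A L) N"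
    using S by (auto simp: belongs_def is_iso_def)
  \<comment> \<open>All local monoids are isomorphic to the stable monoid, hence to
    \<open>N\<close>.\<close>
  have "g \<circ> label e \<in> iso (local_monoid ?C i) N" if "i < s" for i
    using iso_set_trans[OF local_monoid_word_cat[OF s e that], of g N] N(2)
    unfolding lang_stable_monoid_eq(1)[OF st] by (simp add: compose_def)
  then have "?C \<in> local_cats \<V>"
    using finite_category_word_cat[OF s e fin] N(1)
    by (auto simp: local_cats_def cat belongs_def is_iso_def)
  then have "?C \<in> global_cats \<V>" using loc by (simp add: local_variety_def)
  then obtain M \<theta> \<tau> where M: "M \<in> \<V>" and div: "cat_division ?C (monoid_cat M) \<theta> \<tau>"
    by (auto simp: global_cats_def cat_divides_def)
  interpret M: monoid M using monoid_varietyD(2)[OF \<V> M] .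
  have arr: "?a i w \<in> Arr ?C" if "i < s" "w \<in> lists A" for i w
    using that by (auto simp: cat)
  have \<tau>_sub: "\<tau> (?a i w) \<subseteq> carrier M" and \<tau>_ne: "\<tau> (?a i w) \<noteq> {}" if "i < s" "w \<in> lists A" for i w
    using div arr[OF that] unfolding cat_division_def by (fastforce simp: arrows_def monoid_cat_def)+
  have \<tau>_one: "\<one>\<^bsub>M\<^esub> \<in> \<tau> (?a i [])" if "i < s" for i
    using div that unfolding cat_division_def by (auto simp: cat monoid_cat_def)
  have \<tau>_mult: "x \<otimes>\<^bsub>M\<^esub> y \<in> \<tau> (?a i (u @ v))"
    if "i < s" "u \<in> lists A" "v \<in> lists A" "x \<in> \<tau> (?a i u)" "y \<in> \<tau> (?a ((i + length u) mod s) v)"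
    for i u v x y
  proof -
    let ?j = "(i + length u) mod s"
    have "{Comp (monoid_cat M) a b |a b. a \<in> \<tau> (?a i u) \<and> b \<in> \<tau> (?a ?j v)} \<subseteq>
        \<tau> (Comp ?C (?a i u) (?a ?j v))"
      using div arr[OF that(1,2)] arr[of ?j v] s that(3) unfolding cat_division_def
      by (simp add: cat)
    then show ?thesis
      using that(4,5) unfolding Comp_word_cat[OF s e that(2,3) refl] by (auto simp: monoid_cat_def)
  qed
  \<comment> \<open>Lengths with equal residues make the two arrows coterminal, which disjointness
    requires.\<close>
  have \<tau>_disj: "?h u = ?h v" if "i < s" "u \<in> lists A" "v \<in> lists A" "x \<in> \<tau> (?a i u)" "x \<in> \<tau> (?a i v)"
      "length u mod s = length v mod s" for i u v x
  proof -
    have "(i + length u) mod s = (i + length v) mod s" using that(6) by (metis mod_add_right_eq)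
    then have "Dom ?C (?a i u) = Dom ?C (?a i v) \<and> Cod ?C (?a i u) = Cod ?C (?a i v)"
      by (simp add: cat)
    moreover have "\<forall>x\<in>Arr ?C. \<forall>y\<in>Arr ?C. Dom ?C x = Dom ?C y \<and> Cod ?C x = Cod ?C y \<and> x \<noteq> y \<longrightarrow>
        \<tau> x \<inter> \<tau> y = {}"
      using div unfolding cat_division_def by (elim conjE)
    ultimately have "?a i u = ?a i v"
      using arr[OF that(1,2)] arr[OF that(1,3)] that(4,5) by blast
    then show ?thesis using that word_arrow_eq_iff[OF s e] by blast
  qed
  \<comment> \<open>\<open>c\<close> codes the letter \<open>c div s\<close> read at residue
    \<open>c mod s\<close>; any image of that one-letter arrow will do.\<close>
  define m where "m c = (SOME x. x \<in> \<tau> (?a (c mod s) [c div s]))" for c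
  define k where "k w = foldr (\<lambda>c x. m c \<otimes>\<^bsub>M\<^esub> x) w \<one>\<^bsub>M\<^esub>" for w
  let ?A = "annotated_alphabet s A"
  have m: "m (a * s + i mod s) \<in> \<tau> (?a (i mod s) [a])" if "a \<in> A" for a i
    using \<tau>_ne[of "i mod s" "[a]"] s that by (simp add: m_def some_in_eq)
  have mc: "m c \<in> carrier M" if c: "c \<in> ?A" for c
  proof -
    obtain a i where "c = a * s + i" "a \<in> A" "i < s" using c by (auto simp: annotated_alphabet_def)
    then have "m c \<in> \<tau> (?a i [a])" using m[of a i] by simp
    then show ?thesis using \<tau>_sub[of i "[a]"] \<open>a \<in> A\<close> \<open>i < s\<close> by auto
  qed
  have kc: "k w \<in> carrier M" if "w \<in> lists ?A" for w
    using that by (induction w) (auto simp: k_def mc in_lists_conv_set)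
  have kapp: "k (u @ v) = k u \<otimes>\<^bsub>M\<^esub> k v" if "u \<in> lists ?A" "v \<in> lists ?A" for u v
    using that(1)
  proof (induction u)
    case (Cons c u)
    have "k (c # u) = m c \<otimes>\<^bsub>M\<^esub> k u" "k ((c # u) @ v) = m c \<otimes>\<^bsub>M\<^esub> k (u @ v)" by (simp_all add: k_def)
    then show ?case using Cons mc kc[OF that(2)] kc[of u] by (simp add: M.m_assoc)
  qed (use kc[OF that(2)] in \<open>simp add: k_def\<close>)
  have k: "monoid_morphism (free_monoid ?A) M k"
    using kc kapp by (simp add: free_morphism_iff k_def)
  \<comment> \<open>Reading a letter moves the offset to the target of its arrow, so the chosen
    images multiply along consecutive arrows.\<close>
  have k\<tau>: "k (annotate s i w) \<in> \<tau> (?a (i mod s) w)" if "w \<in> lists A" for i w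
    using that
  proof (induction w arbitrary: i)
    case Nil
    then show ?case using \<tau>_one s by (simp add: k_def)
  next
    case (Cons a w)
    have "k (annotate s (Suc i) w) \<in> \<tau> (?a ((i mod s + length [a]) mod s) w)"
      using Cons.IH[of "Suc i"] by (simp add: mod_Suc_eq)
    then have "m (a * s + i mod s) \<otimes>\<^bsub>M\<^esub> k (annotate s (Suc i) w) \<in> \<tau> (?a (i mod s) ([a] @ w))"
      using Cons.hyps m[of a i] s by (intro \<tau>_mult) auto
    then show ?case by (simp add: k_def)
  qed
  \<comment> \<open>With the residue of the length fixed, all arrows from 0 are coterminal, so
    images of words of distinct classes cannot be confused.\<close>
  define L' where "L' r = {x \<in> lists ?A. k x \<in> (\<Union>w\<in>{w \<in> L. length w mod s = r}. \<tau> (?a 0 w))}" for r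
  have mem: "w \<in> L \<longleftrightarrow> annotate s 0 w \<in> L' (length w mod s)" if w: "w \<in> lists A" for w
  proof
    have kw: "k (annotate s 0 w) \<in> \<tau> (?a 0 w)" using k\<tau>[OF w, of 0] by simp
    have ann: "annotate s 0 w \<in> lists ?A" using annotate_in_lists[OF s w] .
    show "annotate s 0 w \<in> L' (length w mod s)" if "w \<in> L"
      using that kw ann by (auto simp only: L'_def)
    assume "annotate s 0 w \<in> L' (length w mod s)"
    then obtain v where v: "v \<in> L" "length v mod s = length w mod s" "k (annotate s 0 w) \<in> \<tau> (?a 0 v)"
      by (auto simp only: L'_def)
    then have "?h w = ?h v" using \<tau>_disj[of 0 w v] kw s w L by auto
    then have "[] @ w @ [] \<in> L \<longleftrightarrow> [] @ v @ [] \<in> L"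
      using syntactic_morphism_eq_iff[of w A v L] w v(1) L by blast
    then show "w \<in> L" using v(1) by simp
  qed
  have "definable F ?A (L' r)" for r
  proof -
    let ?P = "(\<Union>w\<in>{w \<in> L. length w mod s = r}. \<tau> (?a 0 w))"
    have "?P \<subseteq> carrier M" using \<tau>_sub[of 0] s L by blast
    then have "recognizes M ?A (L' r)" using k unfolding recognizes_def L'_def by blast
    moreover have "L' r \<subseteq> lists ?A" by (auto simp only: L'_def)
    ultimately show ?thesis
      using equivalentD[OF eqv finite_annotated_alphabet[OF A]] M by blast
  qed
  then have "\<forall>r. \<exists>\<phi>\<in>F. L' r = formula_lang ?A \<phi>" unfolding definable_def by blast
  then obtain \<phi> where \<phi>: "\<And>r. \<phi> r \<in> F" "\<And>r. L' r = formula_lang ?A (\<phi> r)" by metis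
  \<comment> \<open>The length constant selects the formula made for the residue of the
    length.\<close>
  define \<psi> where "\<psi> r = Conj (map_atoms (from_annotation s) (\<phi> r)) (Pred (mod_const s r) [])" for r
  have \<psi>: "\<psi> r \<in> enrich \<sigma> F (MOD_at s)" if "r < s" for r
    unfolding \<psi>_def
  proof (intro enrich_Conj_Disj(1)[OF _ _ F])
    show "map_atoms (from_annotation s) (\<phi> r) \<in> enrich \<sigma> F (MOD_at s)"
      using from_annotation_enrich[OF \<phi>(1) F s] .
    show "Pred (mod_const s r) [] \<in> enrich \<sigma> F (MOD_at s)"
      using that by (intro enrich_qfree[OF _ _ _ F]) (auto simp: MOD_at_def closed_formula_def)
  qed
  define \<Psi> where "\<Psi> = foldr (\<lambda>r. Disj (\<psi> r)) [0..<s] Fa"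
  have \<Psi>: "foldr (\<lambda>r. Disj (\<psi> r)) rs Fa \<in> enrich \<sigma> F (MOD_at s)" if "set rs \<subseteq> {..<s}" for rs
    using that
  proof (induction rs)
    case Nil
    show ?case by (simp, rule enrich_qfree[OF _ _ _ F]) (auto simp: closed_formula_def)
  next
    case (Cons r rs)
    then show ?case using enrich_Conj_Disj(2)[OF \<psi> _ F] by simp
  qed
  have "\<Psi> \<in> enrich \<sigma> F (MOD_at s)" unfolding \<Psi>_def by (rule \<Psi>) auto
  moreover have "sat w v V (foldr (\<lambda>r. Disj (\<psi> r)) rs Fa) \<longleftrightarrow> (\<exists>r\<in>set rs. sat w v V (\<psi> r))" for w v V rs
    by (induction rs) auto
  then have sat: "sat w v V (\<Psi>) \<longleftrightarrow> (\<exists>r<s. sat w v V (\<psi> r))" for w v V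
    by (auto simp: \<Psi>_def)
  have "w \<in> L \<longleftrightarrow> w \<in> formula_lang A (\<Psi>)" if w: "w \<in> lists A" for w
  proof -
    have "w \<in> L \<longleftrightarrow> sat (annotate s 0 w) (\<lambda>_. 0) (\<lambda>_. {}) (\<phi> (length w mod s))"
      unfolding mem[OF w] \<phi>(2) using annotate_in_lists[OF s w] by (simp add: formula_lang_def)
    also have "\<dots> \<longleftrightarrow> (\<exists>r<s. sat w (\<lambda>_. 0) (\<lambda>_. {}) (\<psi> r))"
      using s by (auto simp: \<psi>_def sat_from_annotation[OF s])
    finally show ?thesis using w by (simp add: formula_lang_def sat)
  qed
  then have "L = formula_lang A (\<Psi>)" using L by (auto simp only: formula_lang_def)
  ultimately show ?thesis by (auto simp: definable_def)
qed

section \<open>Recursive functions\<close>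

abbreviation pfst :: "nat \<Rightarrow> nat" where "pfst x \<equiv> fst (prod_decode x)"
abbreviation psnd :: "nat \<Rightarrow> nat" where "psnd x \<equiv> snd (prod_decode x)"

definition recursive_pred :: "(nat \<Rightarrow> bool) \<Rightarrow> bool" where
  "recursive_pred P \<longleftrightarrow> recursive (\<lambda>n. if P n then 1 else 0)"

lemma recursive_id: "recursive (\<lambda>n. n)"
  using recursive.pair[OF recursive.left recursive.right] by simp

lemma recursive_const: "recursive (\<lambda>_. c)"
proof (induction c)
  case (Suc c)
  then show ?case using recursive.comp[OF recursive.suc Suc] by simp
qed (rule recursive.zero)

lemma recursive_Suc: "recursive f \<Longrightarrow> recursive (\<lambda>n. Suc (f n))"
  using recursive.comp[OF recursive.suc] .

lemma recursive_pfst: "recursive f \<Longrightarrow> recursive (\<lambda>n. pfst (f n))"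
  using recursive.comp[OF recursive.left] .

lemma recursive_psnd: "recursive f \<Longrightarrow> recursive (\<lambda>n. psnd (f n))"
  using recursive.comp[OF recursive.right] .

lemma recursive_comp2:
  assumes "recursive (\<lambda>p. g (pfst p) (psnd p))" "recursive f" "recursive h"
  shows "recursive (\<lambda>n. g (f n) (h n))"
  using recursive.comp[OF assms(1) recursive.pair[OF assms(2,3)]] by simp

lemma recursive_pred_comp2:
  assumes "recursive_pred (\<lambda>p. P (pfst p) (psnd p))" "recursive f" "recursive h"
  shows "recursive_pred (\<lambda>n. P (f n) (h n))"
  using recursive_comp2[OF assms(1)[unfolded recursive_pred_def] assms(2,3)]
  by (simp add: recursive_pred_def)

text \<open>The argument \<open>n\<close> is handed on as the parameter of \<open>prim_rec\<close>,
  so that base, step and number of rounds may all depend on it.\<close>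

lemma recursive_rec_nat:
  assumes "recursive a" "recursive k" "recursive (\<lambda>p. s (pfst p) (pfst (psnd p)) (psnd (psnd p)))"
  shows "recursive (\<lambda>n. rec_nat (a n) (s n) (k n))"
  using recursive.comp[OF recursive.prim_rec[OF assms(1,3)] recursive.pair[OF recursive_id assms(2)]]
  by simp

lemmas recursive_basic = recursive_id recursive_const recursive_Suc recursive_pfst recursive_psnd
  recursive.pair recursive_rec_nat

section \<open>Arithmetic, case distinction and bounded quantifiers\<close>

lemma recursive_add:
  assumes "recursive f" "recursive g"
  shows "recursive (\<lambda>n. f n + g n)"
proof -
  have "x + y = rec_nat x (\<lambda>_ r. Suc r) y" for x y :: nat by (induction y) auto
  then show ?thesis by (simp only:) (intro recursive_basic assms)
qed

lemma recursive_diff: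
  assumes "recursive f" "recursive g"
  shows "recursive (\<lambda>n. f n - g n)"
proof -
  \<comment> \<open>The inner recursor is the predecessor.\<close>
  have "x - y = rec_nat x (\<lambda>_ r. rec_nat 0 (\<lambda>m _. m) r) y" for x y :: nat
  proof (induction y)
    case (Suc y)
    have "rec_nat 0 (\<lambda>m _. m) r = r - 1" for r :: nat by (cases r) auto
    then show ?case using Suc by simp
  qed simp
  then show ?thesis by (simp only:) (intro recursive_basic assms)
qed

lemma recursive_mult:
  assumes "recursive f" "recursive g"
  shows "recursive (\<lambda>n. f n * g n)"
proof -
  have "x * y = rec_nat 0 (\<lambda>_ r. r + x) y" for x y :: nat by (induction y) auto
  then show ?thesis
    by (simp only:) (intro recursive_basic recursive_add recursive.comp[OF assms(1)] assms)
qed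

lemma recursive_power:
  assumes "recursive f" "recursive g"
  shows "recursive (\<lambda>n. f n ^ g n)"
proof -
  have "x ^ y = rec_nat 1 (\<lambda>_ r. r * x) y" for x y :: nat by (induction y) auto
  then show ?thesis
    by (simp only:) (intro recursive_basic recursive_mult recursive.comp[OF assms(1)] assms)
qed

lemma recursive_fact:
  assumes "recursive f"
  shows "recursive (\<lambda>n. fact (f n))"
proof -
  have "fact y = rec_nat 1 (\<lambda>m r. Suc m * r) y" for y :: nat by (induction y) auto
  then show ?thesis by (simp only:) (intro recursive_basic recursive_mult assms)
qed

text \<open>A recursion of one round or none: the base is the second branch, and a round overwrites
  it by the first.\<close>

lemma recursive_If:
  assumes "recursive_pred P" "recursive f" "recursive g"
  shows "recursive (\<lambda>n. if P n then f n else g n)"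
proof -
  have "recursive (\<lambda>n. rec_nat (g n) (\<lambda>_ _. f n) (if P n then 1 else 0))"
    using assms(1) unfolding recursive_pred_def
    by (intro recursive_basic recursive.comp[OF assms(2)] assms(2,3))
  moreover have "rec_nat (g n) (\<lambda>_ _. f n) (if P n then 1 else 0) = (if P n then f n else g n)" for n
    by simp
  ultimately show ?thesis by (simp only:)
qed

lemma recursive_pred_eq:
  assumes "recursive f" "recursive g"
  shows "recursive_pred (\<lambda>n. f n = g n)"
proof -
  \<comment> \<open>Subtraction is truncated, so the sum of both differences is 0 exactly for equal
    numbers.\<close>
  have "(if f n = g n then 1 else 0) = 1 - ((f n - g n) + (g n - f n))" for n by auto
  then show ?thesis unfolding recursive_pred_def
    by (simp only:) (intro recursive_basic recursive_add recursive_diff assms)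
qed

lemma recursive_pred_not:
  assumes "recursive_pred P"
  shows "recursive_pred (\<lambda>n. \<not> P n)"
proof -
  have "(if \<not> P n then 1 else 0) = 1 - (if P n then 1 else (0::nat))" for n by auto
  then show ?thesis using assms unfolding recursive_pred_def
    by (simp only:) (intro recursive_basic recursive_diff)
qed

lemma recursive_pred_all:
  assumes "recursive_pred (\<lambda>p. P (pfst p) (psnd p))" "recursive k"
  shows "recursive_pred (\<lambda>n. \<forall>i<k n. P n i)"
proof -
  have eq: "(if \<forall>i<m. P n i then 1 else 0) = rec_nat 1 (\<lambda>i r. if P n i then r else (0::nat)) m" for n m
    by (induction m) (auto simp: less_Suc_eq)
  have "recursive_pred (\<lambda>p. P (pfst p) (pfst (psnd p)))"
    by (intro recursive_pred_comp2[OF assms(1)] recursive_basic)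
  then have "recursive (\<lambda>n. rec_nat 1 (\<lambda>i r. if P n i then r else 0) (k n))"
    by (intro recursive_basic recursive_If assms(2))
  then show ?thesis unfolding recursive_pred_def eq .
qed

lemma recursive_pred_ex:
  assumes "recursive_pred (\<lambda>p. P (pfst p) (psnd p))" "recursive k"
  shows "recursive_pred (\<lambda>n. \<exists>i<k n. P n i)"
  using recursive_pred_not[OF recursive_pred_all[OF recursive_pred_not[OF assms(1)] assms(2)]] by simp

lemma recursive_mod:
  assumes "recursive f" "recursive g"
  shows "recursive (\<lambda>n. f n mod g n)"
proof -
  \<comment> \<open>A counter restarting at \<open>y\<close>; for \<open>y = 0\<close> it never
    restarts, in accordance with \<open>x mod 0 = x\<close>.\<close>
  have "x mod y = rec_nat 0 (\<lambda>_ r. if Suc r = y then 0 else Suc r) x" for x y :: nat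
    by (induction x) (auto simp: mod_Suc)
  then show ?thesis
    by (simp only:) (intro recursive_basic recursive_If recursive_pred_eq recursive.comp[OF assms(2)] assms)
qed

lemma recursive_div:
  assumes "recursive f" "recursive g"
  shows "recursive (\<lambda>n. f n div g n)"
proof -
  \<comment> \<open>Counts the multiples of \<open>y\<close> from 1 to \<open>x\<close>; for
    \<open>y = 0\<close> there are none, in accordance with \<open>x div 0 = 0\<close>.\<close>
  have "x div y = rec_nat 0 (\<lambda>m r. if Suc m mod y = 0 then Suc r else r) x" for x y :: nat
    by (induction x) (auto simp: div_Suc)
  then show ?thesis
    by (simp only:) (intro recursive_basic recursive_If recursive_pred_eq recursive_mod
      recursive.comp[OF assms(2)] assms)
qed

subsection \<open>Encoded lists\<close>

text \<open>\<open>list_encode\<close> codes the empty list by 0 and any other list by the successor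
  of the pair of its head and the code of its tail, so \<open>psnd (r - 1)\<close> is the
  tail.\<close>

definition code_drop :: "nat \<Rightarrow> nat \<Rightarrow> nat" where
  "code_drop x i = rec_nat x (\<lambda>_ r. psnd (r - 1)) i"

definition code_nth :: "nat \<Rightarrow> nat \<Rightarrow> nat" where
  "code_nth x i = pfst (code_drop x i - 1)"

definition code_length :: "nat \<Rightarrow> nat" where
  "code_length x = (LEAST i. code_drop x i = 0)"

text \<open>The list over the indices below \<open>m\<close> is built from its last entry, so the
  index counts down to obtain ascending order.\<close>

definition code_map :: "(nat \<Rightarrow> nat) \<Rightarrow> nat \<Rightarrow> nat" where
  "code_map g m = rec_nat 0 (\<lambda>i r. Suc (prod_encode (g (m - Suc i), r))) m"

text \<open>The entries come out in descending order; \<open>block_dfa\<close> lists its final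
  states accordingly.\<close>

definition code_filter :: "(nat \<Rightarrow> bool) \<Rightarrow> nat \<Rightarrow> nat" where
  "code_filter P m = rec_nat 0 (\<lambda>i r. if P i then Suc (prod_encode (i, r)) else r) m"

lemma code_drop_encode: "i \<le> length xs \<Longrightarrow> code_drop (list_encode xs) i = list_encode (drop i xs)"
proof (induction i)
  case (Suc i)
  then have "drop i xs = xs ! i # drop (Suc i) xs" by (simp add: Cons_nth_drop_Suc)
  then show ?case using Suc by (simp add: code_drop_def)
qed (simp add: code_drop_def)

lemma code_nth_encode: "i < length xs \<Longrightarrow> code_nth (list_encode xs) i = xs ! i"
  by (simp add: code_nth_def code_drop_encode Cons_nth_drop_Suc[symmetric])

lemma code_length_encode: "code_length (list_encode xs) = length xs"
  unfolding code_length_def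
proof (rule Least_equality)
  show "code_drop (list_encode xs) (length xs) = 0" by (simp add: code_drop_encode)
next
  fix i assume i: "code_drop (list_encode xs) i = 0"
  show "length xs \<le> i"
  proof (rule ccontr)
    assume "\<not> length xs \<le> i"
    then show False
      using i by (simp add: code_drop_encode Cons_nth_drop_Suc[symmetric])
  qed
qed

lemma code_map_encode: "code_map g m = list_encode (map g [0..<m])"
proof -
  have "rec_nat 0 (\<lambda>i r. Suc (prod_encode (g (m - Suc i), r))) i = list_encode (map g [m - i..<m])"
    if "i \<le> m" for i
    using that
  proof (induction i)
    case (Suc i)
    then have "[m - Suc i..<m] = (m - Suc i) # [m - i..<m]"
      by (subst upt_conv_Cons) (auto simp: Suc_diff_Suc)
    then show ?case using Suc by simp
  qed simp
  then show ?thesis by (simp add: code_map_def)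
qed

lemma code_filter_encode: "code_filter P m = list_encode (filter P (rev [0..<m]))"
  by (induction m) (simp_all add: code_filter_def)

lemma recursive_code_drop: "recursive f \<Longrightarrow> recursive g \<Longrightarrow> recursive (\<lambda>n. code_drop (f n) (g n))"
  unfolding code_drop_def by (intro recursive_basic recursive_diff)

lemma recursive_code_nth: "recursive f \<Longrightarrow> recursive g \<Longrightarrow> recursive (\<lambda>n. code_nth (f n) (g n))"
  unfolding code_nth_def by (intro recursive_basic recursive_diff recursive_code_drop)

lemma recursive_code_length:
  assumes "recursive f"
  shows "recursive (\<lambda>n. code_length (f n))"
proof -
  let ?d = "\<lambda>p. code_drop (pfst p) (psnd p)"
  \<comment> \<open>Every number codes a list, so the minimization always succeeds.\<close>
  have "\<exists>m. ?d (prod_encode (n, m)) = 0" for n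
    using code_drop_encode[of "length (list_decode n)" "list_decode n"] by auto
  moreover have "recursive ?d" by (intro recursive_basic recursive_code_drop)
  ultimately have "recursive (\<lambda>n. LEAST m. ?d (prod_encode (n, m)) = 0)" by (intro recursive.mu)
  then show ?thesis using recursive.comp[OF _ assms] by (simp add: code_length_def)
qed

lemma recursive_code_map:
  assumes "recursive (\<lambda>p. g (pfst p) (psnd p))" "recursive m"
  shows "recursive (\<lambda>n. code_map (g n) (m n))"
  unfolding code_map_def
  by (intro recursive_basic recursive_comp2[OF assms(1)] recursive_diff recursive.comp[OF assms(2)] assms(2))

lemma recursive_code_filter:
  assumes "recursive_pred (\<lambda>p. P (pfst p) (psnd p))" "recursive m"
  shows "recursive (\<lambda>n. code_filter (P n) (m n))"
proof -
  have "recursive_pred (\<lambda>p. P (pfst p) (pfst (psnd p)))"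
    by (intro recursive_pred_comp2[OF assms(1)] recursive_basic)
  then show ?thesis
    unfolding code_filter_def by (intro recursive_basic recursive_If assms(2))
qed

lemmas recursive_intros = recursive_basic recursive_add recursive_diff recursive_mult recursive_power
  recursive_fact recursive_mod recursive_div recursive_If recursive_pred_eq recursive_pred_all
  recursive_pred_ex recursive_code_nth recursive_code_length recursive_code_map recursive_code_filter

section \<open>Reduction to the original fragment\<close>

text \<open>The least significant digit comes first, so that words are read off a number by repeated
  \<open>mod\<close> and \<open>div\<close>.\<close>

fun digits :: "nat \<Rightarrow> nat \<Rightarrow> nat \<Rightarrow> nat list" where
  "digits k 0 b = []"
| "digits k (Suc j) b = b mod k # digits k j (b div k)"

lemma digits_image: "digits k j ` {..<k ^ j} = words {..<k} j"
proof (induction j)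
  case 0
  then show ?case by (auto simp: words_def)
next
  case (Suc j)
  show ?case
  proof (intro equalityI subsetI)
    fix w assume "w \<in> digits k (Suc j) ` {..<k ^ Suc j}"
    then obtain b where b: "b < k ^ j * k" "w = b mod k # digits k j (b div k)" by (auto simp: mult.commute)
    then have "digits k j (b div k) \<in> words {..<k} j"
      using Suc less_mult_imp_div_less[OF b(1)] by blast
    moreover have "b mod k < k" using b(1) by (cases "k = 0") auto
    ultimately show "w \<in> words {..<k} (Suc j)" using b(2) by (simp add: words_def)
  next
    fix w assume "w \<in> words {..<k} (Suc j)"
    then obtain c v where w: "w = c # v" "c < k" "v \<in> words {..<k} j"
      by (cases w) (auto simp: words_def)
    then obtain b where b: "b < k ^ j" "v = digits k j b" using Suc by blast
    \<comment> \<open>The first letter \<open>c\<close> becomes the lowest digit.\<close>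
    have "b * k + c < k ^ Suc j"
    proof -
      have "b * k + c < Suc b * k" using w(2) by simp
      also have "\<dots> \<le> k ^ j * k" using b(1) by (intro mult_le_mono1) simp
      finally show ?thesis by (simp add: mult.commute)
    qed
    moreover have "digits k (Suc j) (b * k + c) = w" using w b by simp
    ultimately show "w \<in> digits k (Suc j) ` {..<k ^ Suc j}" by (metis imageI lessThan_iff)
  qed
qed

definition block :: "'a list \<Rightarrow> nat \<Rightarrow> nat \<Rightarrow> 'a list" where
  "block as j b = map ((!) as) (digits (length as) j b)"

lemma block_image: "block as j ` {..<length as ^ j} = words (set as) j"
proof -
  have "block as j ` {..<length as ^ j} = map ((!) as) ` words {..<length as} j"
    unfolding digits_image[symmetric] block_def by (simp add: image_image)
  also have "\<dots> = words (set as) j"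
  proof -
    have "set as = (!) as ` {..<length as}" by (auto simp: set_conv_nth)
    then have "lists (set as) = map ((!) as) ` lists {..<length as}" by (simp add: lists_image)
    then show ?thesis by (auto simp: words_def)
  qed
  finally show ?thesis .
qed

text \<open>Reading a letter runs \<open>D\<close> over a whole block of length \<open>t\<close>.
  Starting after \<open>u\<close> and accepting where \<open>v\<close> leads to acceptance builds
  the context into the automaton.\<close>

definition block_dfa :: "dfa \<Rightarrow> nat \<Rightarrow> nat list \<Rightarrow> nat list \<Rightarrow> dfa" where
  "block_dfa D t u v =
     \<lparr>letters = [0..<length (letters D) ^ t],
      table = map (\<lambda>q. map (\<lambda>b. foldl (dfa_step D) q (block (letters D) t b))
        [0..<length (letters D) ^ t]) [0..<length (table D)],
      start = foldl (dfa_step D) (start D) u,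
      finals = filter (\<lambda>q. foldl (dfa_step D) q v \<in> set (finals D)) (rev [0..<length (table D)])\<rparr>"

context
  fixes D :: dfa and t :: nat
  assumes D: "wf_dfa D"
begin

lemma block_closed:
  assumes "b < length (letters D) ^ t"
  shows "block (letters D) t b \<in> lists (set (letters D))"
  using assms block_image[of "letters D" t] unfolding words_def by blast

lemma start_closed: "start D < length (table D)"
  using D by (simp add: wf_dfa_def)

lemma block_dfa_wf:
  assumes "u \<in> lists (set (letters D))"
  shows "wf_dfa (block_dfa D t u v)"
  using dfa_run_closed[OF D start_closed assms] dfa_run_closed[OF D _ block_closed]
  by (auto simp: wf_dfa_def block_dfa_def)

lemma block_dfa_step:
  assumes "q < length (table D)" "b < length (letters D) ^ t"
  shows "dfa_step (block_dfa D t u v) q b = foldl (dfa_step D) q (block (letters D) t b)"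
proof -
  let ?K = "length (letters D) ^ t"
  let ?row = "map (\<lambda>b. foldl (dfa_step D) q (block (letters D) t b)) [0..<?K]"
  have "map_of (zip [0..<?K] ?row) ([0..<?K] ! b) = Some (?row ! b)"
    using assms(2) by (intro map_of_zip_nth) auto
  then show ?thesis using assms by (simp add: dfa_step_def block_dfa_def)
qed

lemma block_dfa_run:
  assumes "q < length (table D)" "w \<in> lists {..<length (letters D) ^ t}"
  shows "foldl (dfa_step (block_dfa D t u v)) q w =
    foldl (dfa_step D) q (concat (map (block (letters D) t) w))"
  using assms(2,1)
proof (induction w arbitrary: q)
  case (Cons b w)
  then show ?case using dfa_run_closed[OF D _ block_closed[of b], of q] by (simp add: block_dfa_step)
qed simp

lemma block_dfa_lang:
  assumes "u \<in> lists (set (letters D))" "v \<in> lists (set (letters D))"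
  shows "dfa_lang (block_dfa D t u v) =
    {w \<in> lists {..<length (letters D) ^ t}. u @ concat (map (block (letters D) t) w) @ v \<in> dfa_lang D}"
proof -
  let ?e = "block (letters D) t"
  have letters: "set (letters (block_dfa D t u v)) = {..<length (letters D) ^ t}"
    by (auto simp: block_dfa_def)
  have "foldl (dfa_step (block_dfa D t u v)) (start (block_dfa D t u v)) w
      \<in> set (finals (block_dfa D t u v)) \<longleftrightarrow>
      u @ concat (map ?e w) @ v \<in> dfa_lang D"
    if w: "w \<in> lists {..<length (letters D) ^ t}" for w
  proof -
    let ?q = "foldl (dfa_step D) (start D) u"
    have q: "?q < length (table D)" using dfa_run_closed[OF D start_closed assms(1)] .
    have e: "concat (map ?e w) \<in> lists (set (letters D))"
      using w by (induction w) (simp_all add: block_closed)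
    have "foldl (dfa_step (block_dfa D t u v)) (start (block_dfa D t u v)) w =
        foldl (dfa_step D) ?q (concat (map ?e w))"
      using block_dfa_run[OF q w, of u v] by (simp add: block_dfa_def)
    moreover have "foldl (dfa_step D) ?q (concat (map ?e w)) < length (table D)"
      using dfa_run_closed[OF D q e] .
    ultimately show ?thesis
      using assms e by (simp add: dfa_lang_def block_dfa_def)
  qed
  then show ?thesis unfolding dfa_lang_def[of "block_dfa D t u v"] letters by blast
qed

end

subsection \<open>Computing the reduction\<close>

definition code_num_letters :: "nat \<Rightarrow> nat" where
  "code_num_letters x = code_length (pfst x)"

definition code_num_states :: "nat \<Rightarrow> nat" where
  "code_num_states x = code_length (pfst (psnd x))"

text \<open>The iterated pair holds the current state and the digits of \<open>b\<close> not yet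
  read.\<close>

definition code_run :: "nat \<Rightarrow> nat \<Rightarrow> nat \<Rightarrow> nat \<Rightarrow> nat" where
  "code_run x q j b = pfst (rec_nat (prod_encode (q, b))
     (\<lambda>_ r. prod_encode
       (code_nth (code_nth (pfst (psnd x)) (pfst r)) (psnd r mod code_num_letters x),
        psnd r div code_num_letters x)) j)"

text \<open>Each side of the context is given by its length and its number: \<open>i\<close> and
  \<open>a\<close> on the left, \<open>j\<close> and \<open>b\<close> on the right.\<close>

definition code_block_dfa :: "nat \<Rightarrow> nat \<Rightarrow> nat \<Rightarrow> nat \<Rightarrow> nat \<Rightarrow> nat \<Rightarrow> nat" where
  "code_block_dfa x t i a j b =
     prod_encode (code_map (\<lambda>c. c) (code_num_letters x ^ t),
       prod_encode (code_map (\<lambda>q. code_map (\<lambda>c. code_run x q t c) (code_num_letters x ^ t))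
           (code_num_states x),
         prod_encode (code_run x (pfst (psnd (psnd x))) i a,
           code_filter (\<lambda>q. \<exists>l<code_length (psnd (psnd (psnd x))).
             code_nth (psnd (psnd (psnd x))) l = code_run x q j b) (code_num_states x))))"

lemma recursive_code_num:
  assumes "recursive x"
  shows "recursive (\<lambda>n. code_num_letters (x n))" "recursive (\<lambda>n. code_num_states (x n))"
  unfolding code_num_letters_def code_num_states_def by (intro recursive_intros assms)+

lemma recursive_code_run:
  assumes "recursive x" "recursive q" "recursive j" "recursive b"
  shows "recursive (\<lambda>n. code_run (x n) (q n) (j n) (b n))"
  unfolding code_run_def
  by (intro recursive_intros recursive_code_num recursive.comp[OF assms(1)] assms)

lemma recursive_code_block_dfa:
  assumes "recursive x" "recursive t" "recursive i" "recursive a" "recursive j" "recursive b"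
  shows "recursive (\<lambda>n. code_block_dfa (x n) (t n) (i n) (a n) (j n) (b n))"
  unfolding code_block_dfa_def
  by (intro recursive_intros recursive_code_num recursive_code_run recursive.comp[OF assms(1)]
      recursive.comp[OF assms(2)] recursive.comp[OF assms(5)] recursive.comp[OF assms(6)] assms)

section \<open>Agreement of the numerical constructions with the automata\<close>

lemma dfa_encode_parts:
  "pfst (dfa_encode D) = list_encode (letters D)"
  "pfst (psnd (dfa_encode D)) = list_encode (map list_encode (table D))"
  "pfst (psnd (psnd (dfa_encode D))) = start D"
  "psnd (psnd (psnd (dfa_encode D))) = list_encode (finals D)"
  "code_num_letters (dfa_encode D) = length (letters D)"
  "code_num_states (dfa_encode D) = length (table D)"
  by (simp_all add: dfa_encode_def code_num_letters_def code_num_states_def code_length_encode)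

lemma dfa_step_nth:
  assumes "wf_dfa D" "q < length (table D)" "c < length (letters D)"
  shows "dfa_step D q (letters D ! c) = table D ! q ! c"
  using assms map_of_zip_nth[of "letters D" "table D ! q" c]
  by (auto simp: dfa_step_def wf_dfa_def)

lemma code_run_encode:
  assumes "wf_dfa D" "q < length (table D)" "b < length (letters D) ^ j"
  shows "code_run (dfa_encode D) q j b = foldl (dfa_step D) q (block (letters D) j b)"
proof -
  let ?k = "length (letters D)"
  define f where "f r = prod_encode
      (code_nth (code_nth (list_encode (map list_encode (table D))) (pfst r)) (psnd r mod ?k),
       psnd r div ?k)" for r
  \<comment> \<open>The recursor exposes its last round, whereas the induction reads the first
    letter first; a power of \<open>f\<close> can be unfolded from either end.\<close>
  have iter: "rec_nat r (\<lambda>_. f) j = (f ^^ j) r" for r j by (induction j) auto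
  have run: "code_run (dfa_encode D) q j b = pfst ((f ^^ j) (prod_encode (q, b)))" for q j b
    unfolding code_run_def dfa_encode_parts f_def[symmetric] by (simp add: iter)
  show ?thesis
    using assms(2,3)
  proof (induction j arbitrary: q b)
    case 0
    then show ?case by (simp add: run block_def)
  next
    case (Suc j)
    have b: "b < ?k ^ j * ?k" using Suc.prems(2) by (simp add: mult.commute)
    then have c: "b mod ?k < ?k" "b div ?k < ?k ^ j"
      using less_mult_imp_div_less[OF b] by (cases "?k = 0"; simp)+
    have row: "length (table D ! q) = ?k" using assms(1) Suc.prems(1) by (simp add: wf_dfa_def)
    have step: "dfa_step D q (letters D ! (b mod ?k)) = table D ! q ! (b mod ?k)"
      using dfa_step_nth[OF assms(1) Suc.prems(1) c(1)] .
    have "dfa_step D q (letters D ! (b mod ?k)) < length (table D)"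
      using dfa_step_closed[OF assms(1) Suc.prems(1)] c(1) by simp
    moreover have "code_run (dfa_encode D) q (Suc j) b =
        code_run (dfa_encode D) (dfa_step D q (letters D ! (b mod ?k))) j (b div ?k)"
      unfolding run step using Suc.prems(1) c(1) row
      by (simp add: funpow_Suc_right code_nth_encode f_def[of "prod_encode (q, b)"] del: funpow.simps)
    ultimately show ?case using Suc.IH[of _ "b div ?k"] c(2) by (simp add: block_def)
  qed
qed

lemma code_block_dfa_encode:
  assumes D: "wf_dfa D" and "a < length (letters D) ^ i" "b < length (letters D) ^ j"
  shows "code_block_dfa (dfa_encode D) t i a j b =
    dfa_encode (block_dfa D t (block (letters D) i a) (block (letters D) j b))"
proof -
  let ?run = "code_run (dfa_encode D)"
  let ?k = "length (letters D)"
  have "(\<exists>l<length (finals D). code_nth (list_encode (finals D)) l = ?run q j b) \<longleftrightarrow>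
      foldl (dfa_step D) q (block (letters D) j b) \<in> set (finals D)" if "q < length (table D)" for q
    using code_run_encode[OF D that assms(3)] by (auto simp: in_set_conv_nth code_nth_encode)
  then have "filter (\<lambda>q. \<exists>l<length (finals D). code_nth (list_encode (finals D)) l = ?run q j b)
      (rev [0..<length (table D)]) =
    filter (\<lambda>q. foldl (dfa_step D) q (block (letters D) j b) \<in> set (finals D))
      (rev [0..<length (table D)])"
    by (intro filter_cong) auto
  moreover have "map (\<lambda>q. list_encode (map (\<lambda>c. ?run q t c) [0..<?k ^ t])) [0..<length (table D)] =
    map list_encode (map (\<lambda>q. map (\<lambda>b. foldl (dfa_step D) q (block (letters D) t b)) [0..<?k ^ t])
      [0..<length (table D)])"
    using code_run_encode[OF D] by (auto intro!: arg_cong[where f = list_encode])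
  moreover have "start D < length (table D)" using D by (simp add: wf_dfa_def)
  ultimately show ?thesis
    using code_run_encode[OF D _ assms(2), of "start D"]
    unfolding code_block_dfa_def dfa_encode_parts code_map_encode code_filter_encode code_length_encode
    by (simp add: dfa_encode_def block_dfa_def del: map_map)
qed

text \<open>With \<open>N = n ^ n\<close> bounding the size of the syntactic monoid, \<open>fact (2 ^ N)\<close> is a stable
  exponent and all contexts have representatives of length less than \<open>N\<close>.\<close>

definition decide_MOD :: "(nat \<Rightarrow> nat) \<Rightarrow> nat \<Rightarrow> nat" where
  "decide_MOD f x =
     (if \<forall>i<code_num_states x ^ code_num_states x. \<forall>a<code_num_letters x ^ i.
         \<forall>j<code_num_states x ^ code_num_states x. \<forall>b<code_num_letters x ^ j.
         f (code_block_dfa x (fact (2 ^ (code_num_states x ^ code_num_states x))) i a j b) = 1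
      then 1 else 0)"

lemma recursive_decide_MOD:
  assumes "recursive f"
  shows "recursive (decide_MOD f)"
  unfolding decide_MOD_def
  by (intro recursive_intros recursive_code_num recursive_code_block_dfa recursive.comp[OF assms])

text \<open>Turns quantification over short words into bounded quantification over numbers, as in
  \<open>decide_MOD\<close>.\<close>

lemma Ball_words:
  "(\<forall>u\<in>lists (set as). length u < N \<longrightarrow> P u) \<longleftrightarrow> (\<forall>j<N. \<forall>b<length as ^ j. P (block as j b))"
proof -
  have "(\<forall>u\<in>lists (set as). length u < N \<longrightarrow> P u) \<longleftrightarrow> (\<forall>j<N. \<forall>u\<in>words (set as) j. P u)"
    by (auto simp: words_def)
  then show ?thesis unfolding block_image[symmetric] by auto
qed

text \<open>All values of \<open>f\<close> that matter are taken at codes of well-formed automata,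
  where \<open>f\<close> decides definability in \<open>F\<close>;
  \<open>stable_iff_small_contexts_definable\<close> turns the conjunction of the answers into
  membership of the stable monoid.\<close>

lemma decide_MOD_correct:
  assumes \<V>: "monoid_variety \<V>" and eqv: "equivalent F \<V>" and D: "wf_dfa D"
    and f: "\<And>D. wf_dfa D \<Longrightarrow>
      f (dfa_encode D) = (if definable F (set (letters D)) (dfa_lang D) then 1 else 0)"
  shows "decide_MOD f (dfa_encode D) =
    (if belongs (lang_stable_monoid (set (letters D)) (dfa_lang D)) \<V> then 1 else 0)"
proof -
  let ?A = "set (letters D)" and ?as = "letters D"
  let ?N = "length (table D) ^ length (table D)"
  let ?t = "fact (2 ^ ?N)"
  interpret word_morphism "syntactic_monoid ?A (dfa_lang D)" ?A "syntactic_morphism ?A (dfa_lang D)"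
    by (rule syntactic_word_morphism)
  note card = syntactic_card_le[OF D]
  have t: "stable ?t" using stable_fact[OF card] .
  have "f (code_block_dfa (dfa_encode D) ?t i a j b) = 1 \<longleftrightarrow>
      definable F {..<length ?as ^ ?t} {w \<in> lists {..<length ?as ^ ?t}.
        block ?as i a @ concat (map (block ?as ?t) w) @ block ?as j b \<in> dfa_lang D}"
    if "a < length ?as ^ i" "b < length ?as ^ j" for i a j b
  proof -
    let ?D = "block_dfa D ?t (block ?as i a) (block ?as j b)"
    have ctx: "block ?as i a \<in> lists ?A" "block ?as j b \<in> lists ?A"
      using block_closed[OF D that(1)] block_closed[OF D that(2)] .
    have "set (letters ?D) = {..<length ?as ^ ?t}" by (auto simp: block_dfa_def)
    then show ?thesis
      unfolding code_block_dfa_encode[OF D that]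
      using f[OF block_dfa_wf[OF D ctx(1)]] block_dfa_lang[OF D ctx] by simp
  qed
  then have "decide_MOD f (dfa_encode D) =
      (if \<forall>u\<in>lists ?A. length u < ?N \<longrightarrow> (\<forall>v\<in>lists ?A. length v < ?N \<longrightarrow>
        definable F {..<length ?as ^ ?t} {w \<in> lists {..<length ?as ^ ?t}.
          u @ concat (map (block ?as ?t) w) @ v \<in> dfa_lang D}) then 1 else 0)"
    unfolding decide_MOD_def dfa_encode_parts Ball_words by simp
  also have "\<dots> = (if belongs (lang_stable_monoid ?A (dfa_lang D)) \<V> then 1 else 0)"
    using stable_iff_small_contexts_definable[OF \<V> eqv _ card t block_image] by auto
  finally show ?thesis .
qed

section \<open>The equivalences and the transfer of decidability\<close>

theorem theorem6:
  fixes \<sigma> :: "num_pred set" and F :: "formula set" and \<V> :: "nat monoid set"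
  assumes "fragment \<sigma> F"
    and "monoid_variety \<V>"
    and "local_variety \<V>"
    and "equivalent F \<V>"
  shows "(\<forall>A L. finite A \<and> L \<subseteq> lists A \<and> regular A L \<longrightarrow>
            (definable (enrich \<sigma> F MOD) A L \<longleftrightarrow>
              definable (enrich \<sigma> F (MOD_at (lang_stability_index A L))) A L) \<and>
            (definable (enrich \<sigma> F (MOD_at (lang_stability_index A L))) A L \<longleftrightarrow>
              belongs (lang_stable_monoid A L) \<V>)) \<and>
         (decidable_fragment F \<longrightarrow> decidable_fragment (enrich \<sigma> F MOD))"
proof -
  \<comment> \<open>A cycle of implications: from predicates modulo the stability index to all of
    \<open>MOD\<close>, then to the stable monoid, and back.\<close>
  have equivalences:
    "definable (enrich \<sigma> F MOD) A L \<longleftrightarrow> belongs (lang_stable_monoid A L) \<V>"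
    "definable (enrich \<sigma> F (MOD_at (lang_stability_index A L))) A L \<longleftrightarrow>
      belongs (lang_stable_monoid A L) \<V>"
    if L: "L \<subseteq> lists A" "regular A L" for A L
  proof -
    interpret word_morphism "syntactic_monoid A L" A "syntactic_morphism A L"
      by (rule syntactic_word_morphism)
    obtain D where D: "wf_dfa D" "set (letters D) = A" "dfa_lang D = L"
      using L(2) by (auto simp: regular_def)
    have A: "finite A" using D(2) by auto
    have fin: "finite (syntactic_morphism A L ` lists A)" using syntactic_card_le(1)[OF D(1)] D by simp
    let ?s = "lang_stability_index A L"
    \<comment> \<open>Some stable exponent exists, so the least one is stable and in particular
      positive.\<close>
    have s: "stable ?s"
      unfolding lang_stability_index_def using stability_index_stable[OF stable_fact[OF fin order_refl]] .
    then have "MOD_at ?s \<subseteq> MOD" by (auto simp: MOD_def stable_def Suc_le_eq)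
    then have "definable (enrich \<sigma> F (MOD_at ?s)) A L \<Longrightarrow> definable (enrich \<sigma> F MOD) A L"
      using enrich_mono unfolding definable_def by blast
    moreover have "definable (enrich \<sigma> F MOD) A L \<Longrightarrow> belongs (lang_stable_monoid A L) \<V>"
      by (rule definable_MOD_imp_stable[OF assms(1,2,4) A fin])
    moreover have "belongs (lang_stable_monoid A L) \<V> \<Longrightarrow> definable (enrich \<sigma> F (MOD_at ?s)) A L"
      by (rule stable_imp_definable_MOD[OF assms(1,3,4) A L(1) fin s _ assms(2)])
    ultimately show "definable (enrich \<sigma> F MOD) A L \<longleftrightarrow> belongs (lang_stable_monoid A L) \<V>"
      "definable (enrich \<sigma> F (MOD_at ?s)) A L \<longleftrightarrow> belongs (lang_stable_monoid A L) \<V>" by blast+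
  qed
  \<comment> \<open>By the equivalence, deciding definability with \<open>MOD\<close> amounts to
    testing whether the stable monoid is in the variety.\<close>
  have "decidable_fragment (enrich \<sigma> F MOD)" if dec: "decidable_fragment F"
  proof -
    obtain f where f: "recursive f" "\<And>D. wf_dfa D \<Longrightarrow>
        f (dfa_encode D) = (if definable F (set (letters D)) (dfa_lang D) then 1 else 0)"
      using dec unfolding decidable_fragment_def by blast
    have "decide_MOD f (dfa_encode D) =
        (if definable (enrich \<sigma> F MOD) (set (letters D)) (dfa_lang D) then 1 else 0)"
      if D: "wf_dfa D" for D
    proof -
      have "dfa_lang D \<subseteq> lists (set (letters D))" "regular (set (letters D)) (dfa_lang D)"
        using D by (auto simp: dfa_lang_def regular_def)
      then show ?thesis
        using decide_MOD_correct[OF assms(2,4) D f(2)] equivalences(1) by simp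
    qed
    then show ?thesis
      using recursive_decide_MOD[OF f(1)] unfolding decidable_fragment_def by blast
  qed
  then show ?thesis using equivalences by blast
qed

end
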